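(* Let $(E,\tau)$ be a locally solid vector lattice, where $\tau$ is a Fatou topology. Then $C_\tau=E$ holds whenever $E$ has the countable sup property, whenever $C_\tau$ has a countable order basis, and whenever $\tau$ is metrisable. Suppose that $C_\tau=E$, and let $\tau^\delta$ be the extension of $\tau$ to a Fatou topology on the Dedekind completion $E^\delta$ of $E$. Then $\tau^\delta$ is locally interval complete solidly submetrisable.
   Context: All vector lattices are real and Archimedean; linear topologies are Hausdorff. A locally solid topology on a vector lattice is a linear topology such that zero has a neighbourhood basis of solid sets. A subset is order closed if it contains the order limits of nets in it. A Fatou topology is a locally solid topology in which zero has a neighbourhood basis of order closed solid sets; for a Fatou topology $\tau$ on $E$ there is a unique Fatou topology $\tau^\delta$ on $E^\delta$ extending it. A sequence $(V_n)$ of neighbourhoods of zero is normal if $V_{n+1}+V_{n+1}\subseteq V_n$; the carrier $C_\tau$ is the union of the disjoint complements $N^{\mathrm d}$ where $N=\bigcap_n V_n$ ranges over intersections of normal sequences of solid $\tau$-neighbourhoods of zero. An order basis of a vector lattice $G$ is a non-empty $A\subseteq G$ with $A^{\mathrm d}=\{0\}$. $E$ has the countable sup property if every subset with a supremum contains an at most countable subset with the same supremum. A locally solid topology $\sigma$ on a vector lattice $G$ is locally interval complete solidly submetrisable if for every $x\in G^+$ there is a metrisable locally solid topology $\widetilde\sigma_x$ on the band $B_x$ generated by $x$, coarser than $\sigma|_{B_x}$, such that every $\widetilde\sigma_x$-Cauchy sequence in $[0,x]$ is $\widetilde\sigma_x$-convergent to an element of $[0,x]$. *)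

theory Defs
  imports "HOL-Analysis.Analysis"
begin

class vector_lattice = ordered_real_vector + lattice

class archimedean_vector_lattice = vector_lattice +
  assumes archimedean: "\<And>x y. (\<forall>n::nat. real n *\<^sub>R x \<le> y) \<Longrightarrow> x \<le> 0"

definition vabs :: "'a::vector_lattice \<Rightarrow> 'a" where
  "vabs x = sup x (- x)"

definition is_lub_vl :: "'a::order set \<Rightarrow> 'a \<Rightarrow> bool" where
  "is_lub_vl S s \<longleftrightarrow> (\<forall>x\<in>S. x \<le> s) \<and> (\<forall>u. (\<forall>x\<in>S. x \<le> u) \<longrightarrow> s \<le> u)"

definition is_glb_vl :: "'a::order set \<Rightarrow> 'a \<Rightarrow> bool" where
  "is_glb_vl S s \<longleftrightarrow> (\<forall>x\<in>S. s \<le> x) \<and> (\<forall>u. (\<forall>x\<in>S. u \<le> x) \<longrightarrow> u \<le> s)"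

definition downward_directed :: "'a::order set \<Rightarrow> bool" where
  "downward_directed D \<longleftrightarrow> (\<forall>a\<in>D. \<forall>b\<in>D. \<exists>c\<in>D. c \<le> a \<and> c \<le> b)"

definition solid_in :: "'a::vector_lattice set \<Rightarrow> 'a set \<Rightarrow> bool" where
  "solid_in S V \<longleftrightarrow> V \<subseteq> S \<and> (\<forall>x\<in>V. \<forall>y\<in>S. vabs y \<le> vabs x \<longrightarrow> y \<in> V)"

abbreviation solid :: "'a::vector_lattice set \<Rightarrow> bool" where
  "solid V \<equiv> solid_in UNIV V"

definition dcompl :: "'a::vector_lattice set \<Rightarrow> 'a set" where
  "dcompl N = {x. \<forall>y\<in>N. inf (vabs x) (vabs y) = 0}"

definition ideal_vl :: "'a::vector_lattice set \<Rightarrow> bool" where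
  "ideal_vl I \<longleftrightarrow> 0 \<in> I \<and> (\<forall>x\<in>I. \<forall>y\<in>I. x + y \<in> I) \<and> (\<forall>c. \<forall>x\<in>I. c *\<^sub>R x \<in> I) \<and> solid I"

definition band_vl :: "'a::vector_lattice set \<Rightarrow> bool" where
  "band_vl B \<longleftrightarrow> ideal_vl B \<and> (\<forall>S s. S \<subseteq> B \<and> is_lub_vl S s \<longrightarrow> s \<in> B)"

definition band_gen :: "'a::vector_lattice \<Rightarrow> 'a set" where
  "band_gen x = \<Inter> {B. band_vl B \<and> x \<in> B}"

definition order_interval :: "'a::order \<Rightarrow> 'a \<Rightarrow> 'a set" where
  "order_interval a b = {y. a \<le> y \<and> y \<le> b}"

text \<open>Order convergence of a net, expressed through its (eventuality) filter F:
  there is a net decreasing to 0, represented by a non-empty downward directed set D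
  with infimum 0, such that for every d in D eventually |x_alpha - x| <= d.\<close>
definition order_converges :: "'a::vector_lattice filter \<Rightarrow> 'a \<Rightarrow> bool" where
  "order_converges F x \<longleftrightarrow>
     (\<exists>D. D \<noteq> {} \<and> downward_directed D \<and> is_glb_vl D 0 \<and>
          (\<forall>d\<in>D. eventually (\<lambda>y. vabs (y - x) \<le> d) F))"

definition order_closed :: "'a::vector_lattice set \<Rightarrow> bool" where
  "order_closed A \<longleftrightarrow>
     (\<forall>F x. F \<noteq> bot \<and> eventually (\<lambda>y. y \<in> A) F \<and> order_converges F x \<longrightarrow> x \<in> A)"

definition nhd0 :: "'a::vector_lattice topology \<Rightarrow> 'a set \<Rightarrow> bool" where
  "nhd0 T U \<longleftrightarrow> (\<exists>V. openin T V \<and> 0 \<in> V \<and> V \<subseteq> U)"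

definition linear_topology_on :: "'a::vector_lattice set \<Rightarrow> 'a topology \<Rightarrow> bool" where
  "linear_topology_on S T \<longleftrightarrow> topspace T = S \<and> Hausdorff_space T \<and>
     continuous_map (prod_topology T T) T (\<lambda>(x, y). x + y) \<and>
     continuous_map (prod_topology euclideanreal T) T (\<lambda>(c, x). c *\<^sub>R x)"

definition locally_solid_on :: "'a::vector_lattice set \<Rightarrow> 'a topology \<Rightarrow> bool" where
  "locally_solid_on S T \<longleftrightarrow> linear_topology_on S T \<and>
     (\<forall>U. nhd0 T U \<longrightarrow> (\<exists>V. nhd0 T V \<and> solid_in S V \<and> V \<subseteq> U))"

abbreviation locally_solid :: "'a::vector_lattice topology \<Rightarrow> bool" where
  "locally_solid T \<equiv> locally_solid_on UNIV T"

definition fatou_topology :: "'a::vector_lattice topology \<Rightarrow> bool" where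
  "fatou_topology T \<longleftrightarrow> locally_solid T \<and>
     (\<forall>U. nhd0 T U \<longrightarrow> (\<exists>V. nhd0 T V \<and> solid V \<and> order_closed V \<and> V \<subseteq> U))"

definition set_plus_vl :: "'a::vector_lattice set \<Rightarrow> 'a set \<Rightarrow> 'a set" where
  "set_plus_vl A B = {a + b | a b. a \<in> A \<and> b \<in> B}"

definition normal_solid_seq :: "'a::vector_lattice topology \<Rightarrow> (nat \<Rightarrow> 'a set) \<Rightarrow> bool" where
  "normal_solid_seq T V \<longleftrightarrow> (\<forall>n. nhd0 T (V n) \<and> solid (V n) \<and>
      set_plus_vl (V (Suc n)) (V (Suc n)) \<subseteq> V n)"

definition carrier_top :: "'a::vector_lattice topology \<Rightarrow> 'a set" where
  "carrier_top T = \<Union> {dcompl (\<Inter> (range V)) | V. normal_solid_seq T V}"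

definition order_basis_of :: "'a::vector_lattice set \<Rightarrow> 'a set \<Rightarrow> bool" where
  "order_basis_of G A \<longleftrightarrow> A \<noteq> {} \<and> A \<subseteq> G \<and> dcompl A \<inter> G = {0}"

definition countable_sup_property :: "'a::vector_lattice itself \<Rightarrow> bool" where
  "countable_sup_property _ \<longleftrightarrow>
     (\<forall>(S::'a set) s. is_lub_vl S s \<longrightarrow> (\<exists>S'. S' \<subseteq> S \<and> countable S' \<and> is_lub_vl S' s))"

definition dedekind_complete :: "'b::vector_lattice itself \<Rightarrow> bool" where
  "dedekind_complete _ \<longleftrightarrow>
     (\<forall>S::'b set. S \<noteq> {} \<and> (\<exists>u. \<forall>x\<in>S. x \<le> u) \<longrightarrow> (\<exists>s. is_lub_vl S s))"

text \<open>j embeds E as an order dense, majorizing vector sublattice of the Dedekind complete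
  vector lattice F; this characterises the Dedekind completion up to lattice isomorphism.\<close>
definition dedekind_completion_embedding :: "('a::vector_lattice \<Rightarrow> 'b::vector_lattice) \<Rightarrow> bool" where
  "dedekind_completion_embedding j \<longleftrightarrow>
     dedekind_complete TYPE('b) \<and> linear j \<and> inj j \<and>
     (\<forall>x y. j (sup x y) = sup (j x) (j y)) \<and>
     (\<forall>y. \<exists>x. y \<le> j x) \<and>
     (\<forall>y. 0 < y \<longrightarrow> (\<exists>x. 0 < j x \<and> j x \<le> y))"

definition extends_topology :: "('a \<Rightarrow> 'b) \<Rightarrow> 'a topology \<Rightarrow> 'b topology \<Rightarrow> bool" where
  "extends_topology j T Td \<longleftrightarrow> (\<forall>U. openin T U \<longleftrightarrow> (\<exists>W. openin Td W \<and> U = j -` W))"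

definition cauchy_in_lt :: "'a::vector_lattice topology \<Rightarrow> (nat \<Rightarrow> 'a) \<Rightarrow> bool" where
  "cauchy_in_lt T x \<longleftrightarrow> (\<forall>U. nhd0 T U \<longrightarrow> (\<exists>N. \<forall>m\<ge>N. \<forall>n\<ge>N. x m - x n \<in> U))"

definition lics_submetrisable :: "'a::vector_lattice topology \<Rightarrow> bool" where
  "lics_submetrisable \<sigma> \<longleftrightarrow>
     (\<forall>x\<ge>0. \<exists>\<sigma>x. locally_solid_on (band_gen x) \<sigma>x \<and> metrizable_space \<sigma>x \<and>
        (\<forall>U. openin \<sigma>x U \<longrightarrow> openin (subtopology \<sigma> (band_gen x)) U) \<and>
        (\<forall>s. (\<forall>n. s n \<in> order_interval 0 x) \<and> cauchy_in_lt \<sigma>x s \<longrightarrow>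
             (\<exists>l\<in>order_interval 0 x. limitin \<sigma>x s l sequentially)))"

end

theory Submission
  imports Defs "HOL-Library.Lattice_Algebras"
begin

text \<open>
  In a Fatou topology the kernel \<open>N\<close> of a normal sequence of order closed solid neighbourhoods
  is a band that can be made to miss any given positive element, so the carrier is order dense.
  Diagonalising countably many normal sequences puts any countable part of the carrier into a
  single band \<open>dcompl N\<close>; this yields the first two criteria, and under
  metrisability some kernel is \<open>{0}\<close>.

  For the last claim, majorise \<open>x\<close> by an element \<open>j e\<close> and take a normal sequence \<open>V\<close> in \<open>T\<close> whose
  kernel is disjoint from \<open>e\<close>. Order closed solid neighbourhoods \<open>W n\<close> in \<open>Td\<close> with
  \<open>j -` W n \<subseteq> V n\<close> have a kernel disjoint from \<open>x\<close>, by order density of the range of \<open>j\<close>, so they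
  define a metrisable topology on the band generated by \<open>x\<close>. Cauchy sequences in \<open>[0, x]\<close> converge
  to the limit superior of a rapidly converging subsequence, because the \<open>W n\<close> are order closed.
\<close>

subsection \<open>Vector lattices\<close>

instance vector_lattice \<subseteq> lattice_ab_group_add ..

section \<open>Absolute values\<close>

lemma vabs_nonneg [simp]: "0 \<le> vabs (x::'a::vector_lattice)"
proof -
  have "0 = x + - x" by simp
  also have "\<dots> \<le> vabs x + vabs x"
    unfolding vabs_def by (intro add_mono) auto
  finally show ?thesis by simp
qed

lemma vabs_ge_self: "x \<le> vabs (x::'a::vector_lattice)"
  and vabs_ge_minus: "- x \<le> vabs x"
  by (simp_all add: vabs_def)

lemma vabs_leI: "x \<le> a \<Longrightarrow> - x \<le> a \<Longrightarrow> vabs (x::'a::vector_lattice) \<le> a"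
  by (simp add: vabs_def)

lemma vabs_of_nonneg [simp]: "0 \<le> x \<Longrightarrow> vabs (x::'a::vector_lattice) = x"
  by (intro order.antisym vabs_leI vabs_ge_self) (auto intro: order_trans[of _ 0])

lemma vabs_minus [simp]: "vabs (- x) = vabs (x::'a::vector_lattice)"
  by (simp add: vabs_def sup_commute)

lemma vabs_0_iff [simp]: "vabs x = 0 \<longleftrightarrow> x = (0::'a::vector_lattice)"
  by (simp add: vabs_def)

lemma vabs_triangle: "vabs (x + y) \<le> vabs x + vabs (y::'a::vector_lattice)"
proof (rule vabs_leI)
  show "x + y \<le> vabs x + vabs y" by (intro add_mono vabs_ge_self)
  have "- x + - y \<le> vabs x + vabs y" by (intro add_mono vabs_ge_minus)
  then show "- (x + y) \<le> vabs x + vabs y" by simp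
qed

lemma vabs_scaleR: "vabs (c *\<^sub>R x) \<le> \<bar>c\<bar> *\<^sub>R vabs (x::'a::vector_lattice)"
proof -
  have nonneg: "vabs (d *\<^sub>R y) \<le> d *\<^sub>R vabs y" if "0 \<le> d" for d and y :: 'a
  proof (rule vabs_leI)
    show "d *\<^sub>R y \<le> d *\<^sub>R vabs y"
      by (rule scaleR_left_mono[OF vabs_ge_self that])
    show "- (d *\<^sub>R y) \<le> d *\<^sub>R vabs y"
      using scaleR_left_mono[OF vabs_ge_minus that, of y] by (simp only: scaleR_minus_right)
  qed
  show ?thesis
    using nonneg[of c x] nonneg[of "- c" "- x"] by (cases "0 \<le> c") simp_all
qed

lemma vabs_scaleR_le: "\<bar>c\<bar> \<le> 1 \<Longrightarrow> vabs (c *\<^sub>R x) \<le> vabs (x::'a::vector_lattice)"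
  using vabs_scaleR[of c x] scaleR_right_mono[of "\<bar>c\<bar>" 1 "vabs x"] by auto

text \<open>The right side distributes into the infimum of \<open>a + a\<close>,
  \<open>a + c\<close>, \<open>b + a\<close> and \<open>b + c\<close>. By positivity the first three
  dominate \<open>a\<close>, and the fourth is \<open>b + c\<close> itself.\<close>

lemma inf_add_le:
  fixes a b c :: "'a::vector_lattice"
  assumes "0 \<le> a" "0 \<le> b" "0 \<le> c"
  shows "inf a (b + c) \<le> inf a b + inf a c"
proof -
  have "inf a (b + c) \<le> inf (inf (a + a) (a + c)) (inf (b + a) (b + c))"
    using assms by (simp add: le_infI1 add_increasing add_increasing2)
  then show ?thesis
    by (simp add: add_inf_distrib_left add_inf_distrib_right inf.assoc inf.commute inf.left_commute)
qed

section \<open>Disjoint complements\<close>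

lemma dcompl_D: "x \<in> dcompl N \<Longrightarrow> y \<in> N \<Longrightarrow> inf (vabs x) (vabs y) = 0"
  by (simp add: dcompl_def)

lemma dcompl_antimono: "A \<subseteq> B \<Longrightarrow> dcompl B \<subseteq> dcompl A"
  by (auto simp: dcompl_def)

lemma subset_dcompl_iff: "A \<subseteq> dcompl B \<longleftrightarrow> B \<subseteq> dcompl A"
  unfolding dcompl_def by (auto 0 4 intro: trans[OF inf_commute])

lemma inf_eq_0_mono:
  fixes a b c :: "'a::vector_lattice"
  shows "inf a c = 0 \<Longrightarrow> 0 \<le> b \<Longrightarrow> b \<le> a \<Longrightarrow> 0 \<le> c \<Longrightarrow> inf b c = 0"
  using inf_mono[of b a c c] by (intro order.antisym) auto

lemma dcompl_add:
  assumes "x \<in> dcompl N" "y \<in> dcompl N"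
  shows "x + y \<in> dcompl N"
  unfolding dcompl_def
proof safe
  fix z assume z: "z \<in> N"
  have "inf (vabs z) (vabs x + vabs y) \<le> inf (vabs z) (vabs x) + inf (vabs z) (vabs y)"
    by (intro inf_add_le) auto
  moreover have "inf (vabs z) (vabs x) = 0" "inf (vabs z) (vabs y) = 0"
    using assms z by (simp_all add: dcompl_def inf.commute[of "vabs z"])
  moreover have "0 \<le> inf (vabs z) (vabs x + vabs y)" by (simp add: add_nonneg_nonneg)
  ultimately have "inf (vabs z) (vabs x + vabs y) = 0" by (intro order.antisym) simp_all
  then have "inf (vabs x + vabs y) (vabs z) = 0" by (simp add: inf.commute)
  then show "inf (vabs (x + y)) (vabs z) = 0"
    by (rule inf_eq_0_mono) (auto simp: vabs_triangle)
qed

section \<open>Solid sets, ideals and bands\<close>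

lemma solid_inD: "solid V \<Longrightarrow> x \<in> V \<Longrightarrow> vabs y \<le> vabs x \<Longrightarrow> y \<in> V"
  by (auto simp: solid_in_def)

lemma solidI: "(\<And>x y. x \<in> V \<Longrightarrow> vabs y \<le> vabs x \<Longrightarrow> y \<in> V) \<Longrightarrow> solid V"
  by (auto simp: solid_in_def)

lemma solid_INT: "(\<And>i. i \<in> I \<Longrightarrow> solid (V i)) \<Longrightarrow> solid (\<Inter>i\<in>I. V i)"
  by (rule solidI) (auto intro: solid_inD)

lemma solid_minus: "solid V \<Longrightarrow> x \<in> V \<Longrightarrow> - x \<in> V"
  by (erule solid_inD) auto

lemma solid_between: "solid V \<Longrightarrow> x \<in> V \<Longrightarrow> 0 \<le> y \<Longrightarrow> y \<le> x \<Longrightarrow> y \<in> V"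
  by (erule solid_inD) auto

lemma solid_scaleR: "solid V \<Longrightarrow> x \<in> V \<Longrightarrow> \<bar>c\<bar> \<le> 1 \<Longrightarrow> c *\<^sub>R x \<in> V"
  by (erule solid_inD) (auto simp: vabs_scaleR_le)

lemma solid_dcompl: "solid (dcompl N)"
  unfolding solid_in_def dcompl_def by (auto intro: inf_eq_0_mono)

text \<open>Scalar multiples come for free: natural multiples are iterated sums, and
  \<open>c *\<^sub>R x\<close> is dominated by the multiple of \<open>x\<close> by
  \<open>\<bar>c\<bar>\<close> rounded up.\<close>

lemma additive_solid_ideal:
  assumes "0 \<in> I" "\<And>x y. x \<in> I \<Longrightarrow> y \<in> I \<Longrightarrow> x + y \<in> I" "solid I"
  shows "ideal_vl I"
proof -
  have "real n *\<^sub>R x \<in> I" if "x \<in> I" for n x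
    using that assms by (induction n) (auto simp: scaleR_add_left)
  moreover have "vabs (c *\<^sub>R x) \<le> vabs (real (nat \<lceil>\<bar>c\<bar>\<rceil>) *\<^sub>R x)" for c and x :: 'a
  proof -
    let ?n = "real (nat \<lceil>\<bar>c\<bar>\<rceil>)"
    have n: "\<bar>c\<bar> \<le> ?n" by linarith
    show ?thesis
    proof (cases "?n = 0")
      case False
      then have "c *\<^sub>R x = (c / ?n) *\<^sub>R (?n *\<^sub>R x)" by simp
      moreover have "\<bar>c / ?n\<bar> \<le> 1" using n False by (simp add: abs_divide divide_le_eq)
      ultimately show ?thesis by (metis vabs_scaleR_le)
    qed (use n in auto)
  qed
  ultimately have "c *\<^sub>R x \<in> I" if "x \<in> I" for c x
    using that assms(3) by (meson solid_inD)
  with assms show ?thesis unfolding ideal_vl_def by blast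
qed

lemma dcompl_ideal: "ideal_vl (dcompl N)"
  by (intro additive_solid_ideal dcompl_add solid_dcompl) (auto simp: dcompl_def inf_absorb1)

lemma sup_eq_add_if_disjoint: "inf a b = 0 \<Longrightarrow> sup a b = a + (b::'a::vector_lattice)"
  by (metis add_eq_inf_sup add_0_right)

lemma vabs_le_sup_add: "vabs x \<le> sup x 0 + sup (- x) (0::'a::vector_lattice)"
  by (intro vabs_leI) (auto intro: add_increasing add_increasing2)

text \<open>By solidity it suffices to treat the positive and negative parts of \<open>s\<close>.
  The negative part is dominated by any \<open>t0\<close> in \<open>S\<close>; the positive part
  rests on \<open>s\<close> being the least upper bound.\<close>

lemma dcompl_band: "band_vl (dcompl (N::'a::vector_lattice set))"
  unfolding band_vl_def
proof (intro conjI allI impI dcompl_ideal)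
  fix S and s :: 'a
  assume "S \<subseteq> dcompl N \<and> is_lub_vl S s"
  then have S: "S \<subseteq> dcompl N" and s: "\<And>t. t \<in> S \<Longrightarrow> t \<le> s" "\<And>u. (\<And>t. t \<in> S \<Longrightarrow> t \<le> u) \<Longrightarrow> s \<le> u"
    by (auto simp: is_lub_vl_def)
  show "s \<in> dcompl N"
  proof (cases "S = {}")
    case True
    \<comment> \<open>A supremum of the empty set lies below every element, in particular below
      \<open>0\<close> and below \<open>s + s\<close>, which forces \<open>s = 0\<close>.\<close>
    then have "s \<le> s + s" "s \<le> 0" using s(2) by blast+
    then have "s = 0" by (intro order.antisym) auto
    then show ?thesis using dcompl_ideal[of N] by (simp add: ideal_vl_def)
  next
    case False
    then obtain t0 where t0: "t0 \<in> S" by blast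
    have neg: "sup (- s) 0 \<in> dcompl N"
    proof (rule solid_inD[OF solid_dcompl])
      show "t0 \<in> dcompl N" using t0 S by blast
      have "- s \<le> - t0" using s(1)[OF t0] by simp
      also have "\<dots> \<le> vabs t0" by (rule vabs_ge_minus)
      finally show "vabs (sup (- s) 0) \<le> vabs t0" by simp
    qed
    have pos: "sup s 0 \<in> dcompl N"
      unfolding dcompl_def
    proof safe
      fix y assume y: "y \<in> N"
      \<comment> \<open>As \<open>?z\<close> is disjoint from \<open>sup t 0\<close> for all \<open>t \<in> S\<close>, also \<open>sup s 0 - ?z\<close> bounds \<open>S\<close>.\<close>
      let ?z = "inf (sup s 0) (vabs y)"
      have z: "0 \<le> ?z" by simp
      have "t \<le> sup s 0 - ?z" if t: "t \<in> S" for t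
      proof -
        have "sup t 0 \<in> dcompl N"
          by (rule solid_inD[OF solid_dcompl, of t]) (use t S vabs_ge_self in auto)
        then have "inf (vabs y) (sup t 0) = 0" using y by (auto simp: dcompl_def inf_commute)
        then have "inf ?z (sup t 0) = 0" by (rule inf_eq_0_mono) auto
        then have "sup t 0 + ?z = sup (sup t 0) ?z"
          by (subst sup_eq_add_if_disjoint) (auto simp: inf_commute)
        also have "\<dots> \<le> sup s 0" using s(1)[OF t] by (simp add: le_supI1)
        finally have "sup t 0 \<le> sup s 0 - ?z" by (simp only: le_diff_eq)
        then show ?thesis by (rule order_trans[OF sup_ge1])
      qed
      then have "s \<le> sup s 0 - ?z" by (rule s(2))
      moreover have "0 \<le> sup s 0 - ?z" by (simp only: diff_ge_0_iff_ge inf_le1)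
      ultimately have "sup s 0 \<le> sup s 0 - ?z" by (rule sup_least)
      then have "?z \<le> 0" by (simp only: le_diff_eq add_le_same_cancel1)
      with z have "?z = 0" by (rule order.antisym[rotated])
      then show "inf (vabs (sup s 0)) (vabs y) = 0" by simp
    qed
    show ?thesis
      by (rule solid_inD[OF solid_dcompl dcompl_add[OF pos neg]])
        (use vabs_le_sup_add[of s] in \<open>simp add: add_nonneg_nonneg\<close>)
  qed
qed

text \<open>The set \<open>S\<close>, indexed by itself, is a net increasing to \<open>s\<close>.
  Its filter \<open>F\<close> is generated by the tails of \<open>S\<close>, and the differences
  \<open>s - a\<close> decrease to \<open>0\<close> and witness order convergence.\<close>

lemma order_closed_directed_lub:
  fixes A :: "'a::vector_lattice set"
  assumes A: "order_closed A" and S: "S \<noteq> {}" "S \<subseteq> A" "is_lub_vl S s"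
    and dir: "\<And>a b. a \<in> S \<Longrightarrow> b \<in> S \<Longrightarrow> \<exists>c\<in>S. a \<le> c \<and> b \<le> c"
  shows "s \<in> A"
proof -
  define F where "F = (INF a\<in>S. principal {y\<in>S. a \<le> y})"
  have base: "eventually P F \<longleftrightarrow> (\<exists>a\<in>S. \<forall>y\<in>S. a \<le> y \<longrightarrow> P y)" for P
    unfolding F_def
  proof (subst eventually_INF_base)
    show "S \<noteq> {}" by fact
    fix a b assume "a \<in> S" "b \<in> S"
    then obtain c where c: "c \<in> S" "a \<le> c" "b \<le> c" using dir by blast
    show "\<exists>x\<in>S. principal {y\<in>S. x \<le> y} \<le> inf (principal {y\<in>S. a \<le> y}) (principal {y\<in>S. b \<le> y})"
      by (rule bexI[OF _ c(1)]) (use c in \<open>auto intro: order_trans\<close>)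
  qed (auto simp: eventually_principal)
  have "F \<noteq> bot" using base[of "\<lambda>_. False"] by (auto simp: trivial_limit_def)
  moreover have "eventually (\<lambda>y. y \<in> A) F" using S by (auto simp: base)
  moreover have "order_converges F s"
    unfolding order_converges_def
  proof (intro exI conjI ballI)
    let ?D = "(\<lambda>a. s - a) ` S"
    show "?D \<noteq> {}" using S by simp
    show "downward_directed ?D"
      unfolding downward_directed_def
    proof safe
      fix a b assume "a \<in> S" "b \<in> S"
      then obtain c where c: "c \<in> S" "a \<le> c" "b \<le> c" using dir by blast
      show "\<exists>d\<in>?D. d \<le> s - a \<and> d \<le> s - b"
        by (rule bexI[of _ "s - c"]) (use c in \<open>auto intro: diff_left_mono\<close>)
    qed
    show "is_glb_vl ?D 0"
      unfolding is_glb_vl_def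
    proof (intro conjI allI impI ballI)
      fix x assume "x \<in> ?D" then show "0 \<le> x" using S by (auto simp: is_lub_vl_def)
    next
      fix u assume "\<forall>x\<in>?D. u \<le> x"
      then have "\<forall>a\<in>S. a \<le> s - u" by (auto simp: algebra_simps)
      then have "s \<le> s - u" using S by (auto simp: is_lub_vl_def)
      then show "u \<le> 0" by simp
    qed
    fix d assume "d \<in> ?D"
    then obtain a where a: "a \<in> S" "d = s - a" by auto
    have "vabs (y - s) \<le> d" if "y \<in> S" "a \<le> y" for y
    proof -
      have "y \<le> s" using that S by (auto simp: is_lub_vl_def)
      moreover have "vabs (y - s) = vabs (s - y)" using vabs_minus[of "y - s"] by simp
      ultimately show ?thesis using that a by (simp add: diff_left_mono)
    qed
    then show "eventually (\<lambda>y. vabs (y - s) \<le> d) F" using a by (auto simp: base)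
  qed
  ultimately show ?thesis using A unfolding order_closed_def by blast
qed

text \<open>If an upper bound \<open>u\<close> is not above \<open>x\<close>, the gap
  \<open>x - inf x u\<close> dominates some \<open>y > 0\<close> in \<open>I\<close>. Each multiple
  of \<open>y\<close> below \<open>x\<close> lies in \<open>I\<close>, hence below
  \<open>inf x u\<close>, so one more \<open>y\<close> still fits below \<open>x\<close>. All
  multiples of \<open>y\<close> are thus bounded by \<open>x\<close>, against the Archimedean
  property.\<close>

lemma order_dense_lub:
  fixes x :: "'a::archimedean_vector_lattice"
  assumes I: "ideal_vl I"
    and dense: "\<And>y. 0 < y \<Longrightarrow> y \<le> x \<Longrightarrow> \<exists>z\<in>I. 0 < z \<and> z \<le> y"
    and x: "0 \<le> x"
  shows "is_lub_vl {z\<in>I. 0 \<le> z \<and> z \<le> x} x"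
  unfolding is_lub_vl_def
proof (intro conjI allI impI ballI)
  fix u assume u: "\<forall>z\<in>{z\<in>I. 0 \<le> z \<and> z \<le> x}. z \<le> u"
  define w where "w = x - inf x u"
  have "0 \<in> I" using I by (simp add: ideal_vl_def)
  then have "0 \<le> u" using u x by auto
  then have "0 \<le> inf x u" using x by simp
  then have "x - inf x u \<le> x" by (simp only: diff_le_eq le_add_same_cancel1)
  moreover have "0 \<le> x - inf x u" by (simp only: diff_ge_0_iff_ge inf_le1)
  ultimately have w: "0 \<le> w" "w \<le> x" by (simp_all only: w_def)
  have "w = 0"
  proof (rule ccontr)
    assume "w \<noteq> 0"
    then obtain y where y: "y \<in> I" "0 < y" "y \<le> w" using dense w by force
    have "real n *\<^sub>R y \<le> x" for n
    proof (induction n)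
      case (Suc n)
      have "real n *\<^sub>R y \<in> I" using I y by (auto simp: ideal_vl_def)
      moreover have "0 \<le> real n *\<^sub>R y" using y by (intro scaleR_nonneg_nonneg) auto
      ultimately have "real n *\<^sub>R y \<le> inf x u" using u Suc by auto
      then have "y + real n *\<^sub>R y \<le> w + inf x u" using y by (intro add_mono)
      then have "y + real n *\<^sub>R y \<le> x" by (simp only: w_def diff_add_cancel)
      then show ?case by (simp add: scaleR_add_left)
    qed (use x in auto)
    then have "y \<le> 0" using archimedean by blast
    with y show False by simp
  qed
  then have "inf x u = x" by (simp only: w_def right_minus_eq)
  then show "x \<le> u" by (simp only: inf.absorb_iff1)
qed auto

subsection \<open>Linear and Fatou topologies\<close>

lemma set_plus_vl_subset_iff: "set_plus_vl A B \<subseteq> C \<longleftrightarrow> (\<forall>a\<in>A. \<forall>b\<in>B. a + b \<in> C)"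
  by (auto simp: set_plus_vl_def)

lemma nhd0_zero: "nhd0 T U \<Longrightarrow> 0 \<in> U"
  by (auto simp: nhd0_def)

lemma nhd0_Int:
  assumes "nhd0 T U" "nhd0 T V" shows "nhd0 T (U \<inter> V)"
proof -
  obtain U' V' where "openin T U'" "0 \<in> U'" "U' \<subseteq> U" "openin T V'" "0 \<in> V'" "V' \<subseteq> V"
    using assms by (auto simp: nhd0_def)
  then show ?thesis unfolding nhd0_def by (intro exI[of _ "U' \<inter> V'"]) (auto simp: openin_Int)
qed

lemma linear_topology_topspace: "linear_topology_on UNIV T \<Longrightarrow> topspace T = UNIV"
  by (simp add: linear_topology_on_def)

lemma nhd0_UNIV: "linear_topology_on UNIV T \<Longrightarrow> nhd0 T UNIV"
  unfolding nhd0_def using linear_topology_topspace openin_topspace by fastforce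

lemma nhd0_plus:
  assumes T: "linear_topology_on UNIV T" and U: "nhd0 T U"
  obtains V where "nhd0 T V" "set_plus_vl V V \<subseteq> U"
proof -
  obtain O' where O: "openin T O'" "0 \<in> O'" "O' \<subseteq> U" using U by (auto simp: nhd0_def)
  have "continuous_map (prod_topology T T) T (\<lambda>(x, y). x + y)"
    using T by (simp add: linear_topology_on_def)
  then have "openin (prod_topology T T) {p. case p of (x, y) \<Rightarrow> x + y \<in> O'}"
    using O(1) linear_topology_topspace[OF T] unfolding continuous_map_def
    by (auto simp: case_prod_unfold)
  then obtain A B where "openin T A" "openin T B" "0 \<in> A" "0 \<in> B"
    "A \<times> B \<subseteq> {p. case p of (x, y) \<Rightarrow> x + y \<in> O'}"
    unfolding openin_prod_topology_alt using O(2) by (force dest: spec[of _ 0])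
  with O(3) have "nhd0 T (A \<inter> B)" "set_plus_vl (A \<inter> B) (A \<inter> B) \<subseteq> U"
    by (auto simp: nhd0_def set_plus_vl_subset_iff intro!: openin_Int exI[of _ "A \<inter> B"])
  then show thesis by (rule that)
qed

text \<open>Moves neighbourhoods of zero to an arbitrary point, by continuity of subtracting
  \<open>x\<close>.\<close>

lemma nhd0_translate:
  assumes T: "linear_topology_on UNIV T" and U: "nhd0 T U"
  obtains V where "openin T V" "x \<in> V" "\<And>y. y \<in> V \<Longrightarrow> y - x \<in> U"
proof -
  obtain O' where O: "openin T O'" "0 \<in> O'" "O' \<subseteq> U" using U by (auto simp: nhd0_def)
  have "continuous_map T (prod_topology T T) (\<lambda>y. (y, - x))"
    using linear_topology_topspace[OF T] by (simp add: continuous_map_pairwise o_def)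
  moreover have "continuous_map (prod_topology T T) T (\<lambda>(x, y). x + y)"
    using T by (simp add: linear_topology_on_def)
  ultimately have "continuous_map T T (\<lambda>y. y - x)"
    by (auto dest: continuous_map_compose simp: o_def)
  then have "openin T {y. y - x \<in> O'}"
    using O(1) linear_topology_topspace[OF T] unfolding continuous_map_def by auto
  then show thesis by (rule that) (use O in auto)
qed

text \<open>Continuity of the line \<open>c *\<^sub>R x\<close> at \<open>c = 0\<close>. It later
  yields continuity of scalar multiplication for the metrised topology.\<close>

lemma nhd0_absorbing:
  assumes T: "linear_topology_on UNIV T" and U: "nhd0 T U"
  obtains \<delta> where "\<delta> > 0" "\<And>c. \<bar>c\<bar> < \<delta> \<Longrightarrow> c *\<^sub>R x \<in> U"
proof -
  obtain O' where O: "openin T O'" "0 \<in> O'" "O' \<subseteq> U" using U by (auto simp: nhd0_def)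
  have "continuous_map euclideanreal (prod_topology euclideanreal T) (\<lambda>c. (c, x))"
    using linear_topology_topspace[OF T] by (simp add: continuous_map_pairwise o_def)
  moreover have "continuous_map (prod_topology euclideanreal T) T (\<lambda>(c, x). c *\<^sub>R x)"
    using T by (simp add: linear_topology_on_def)
  ultimately have "continuous_map euclideanreal T (\<lambda>c. c *\<^sub>R x)"
    by (auto dest: continuous_map_compose simp: o_def)
  then have "open {c. c *\<^sub>R x \<in> O'}"
    using O(1) unfolding continuous_map_def by auto
  moreover have "0 \<in> {c. c *\<^sub>R x \<in> O'}" using O by simp
  ultimately obtain \<delta> where "\<delta> > 0" "ball 0 \<delta> \<subseteq> {c. c *\<^sub>R x \<in> O'}"
    using open_contains_ball by blast
  then show thesis using O by (intro that) (auto simp: subset_iff)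
qed

lemma nhd0_separates:
  assumes T: "linear_topology_on UNIV T" and x: "x \<noteq> 0"
  obtains U where "nhd0 T U" "x \<notin> U"
proof -
  have "Hausdorff_space T" "topspace T = UNIV"
    using T by (simp_all add: linear_topology_on_def)
  then obtain U V where "openin T U" "openin T V" "0 \<in> U" "x \<in> V" "disjnt U V"
    using x unfolding Hausdorff_space_def by (metis UNIV_I)
  then show thesis by (intro that[of U]) (auto simp: nhd0_def disjnt_iff)
qed

lemma fatou_linear: "fatou_topology T \<Longrightarrow> linear_topology_on UNIV T"
  by (simp add: fatou_topology_def locally_solid_on_def)

text \<open>Dependent choice: the next set is taken inside \<open>U (Suc n)\<close> and inside a
  neighbourhood whose sum with itself lies in the current set. Prescribing \<open>U\<close> controls
  the kernel: it can be made to miss a point, to shrink to zero, or to be compatible with another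
  normal sequence.\<close>

lemma fatou_normal_seq:
  assumes T: "fatou_topology T" and U: "\<And>n::nat. nhd0 T (U n)"
  shows "\<exists>V. normal_solid_seq T V \<and> (\<forall>n. order_closed (V n) \<and> V n \<subseteq> U n)"
proof -
  let ?P = "\<lambda>n V. nhd0 T V \<and> solid V \<and> order_closed V \<and> V \<subseteq> U n"
  have "\<exists>V. \<forall>n. ?P n (V n) \<and> set_plus_vl (V (Suc n)) (V (Suc n)) \<subseteq> V n"
  proof (rule dependent_nat_choice)
    show "\<exists>V. ?P 0 V" using T U unfolding fatou_topology_def by blast
  next
    fix V n assume "?P n V"
    then obtain W where W: "nhd0 T W" "set_plus_vl W W \<subseteq> V"
      using nhd0_plus fatou_linear[OF T] by blast
    then have "nhd0 T (W \<inter> U (Suc n))" using U nhd0_Int by blast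
    then obtain V' where "nhd0 T V'" "solid V'" "order_closed V'" "V' \<subseteq> W \<inter> U (Suc n)"
      using T unfolding fatou_topology_def by blast
    with W(2) show "\<exists>V'. ?P (Suc n) V' \<and> set_plus_vl V' V' \<subseteq> V"
      by (intro exI[of _ V']) (auto simp: set_plus_vl_subset_iff)
  qed
  then obtain V where V: "\<And>n. ?P n (V n) \<and> set_plus_vl (V (Suc n)) (V (Suc n)) \<subseteq> V n"
    by blast
  then show ?thesis by (intro exI[of _ V]) (auto simp: normal_solid_seq_def)
qed

section \<open>Normal sequences and their kernels\<close>

lemma normal_seq_add: "normal_solid_seq T V \<Longrightarrow> a \<in> V (Suc n) \<Longrightarrow> b \<in> V (Suc n) \<Longrightarrow> a + b \<in> V n"
  unfolding normal_solid_seq_def set_plus_vl_subset_iff by blast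

lemma normal_seq_solid: "normal_solid_seq T V \<Longrightarrow> solid (V n)"
  by (simp add: normal_solid_seq_def)

lemma normal_seq_nhd0: "normal_solid_seq T V \<Longrightarrow> nhd0 T (V n)"
  by (simp add: normal_solid_seq_def)

lemma normal_seq_antimono:
  assumes V: "normal_solid_seq T V" and "m \<le> n"
  shows "V n \<subseteq> V m"
proof (rule lift_Suc_antimono_le[OF _ \<open>m \<le> n\<close>])
  fix k show "V (Suc k) \<subseteq> V k"
    using normal_seq_add[OF V, of _ k 0] nhd0_zero[OF normal_seq_nhd0[OF V]] by fastforce
qed

lemma normal_seq_Inter_ideal:
  assumes V: "normal_solid_seq T V"
  shows "ideal_vl (\<Inter> (range V))"
proof (rule additive_solid_ideal)
  show "solid (\<Inter> (range V))"
    by (intro solid_INT normal_seq_solid[OF V])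
qed (use normal_seq_add[OF V] nhd0_zero[OF normal_seq_nhd0[OF V]] in auto)

subsection \<open>The carrier\<close>

lemma carrier_top_iff:
  "x \<in> carrier_top T \<longleftrightarrow> (\<exists>V. normal_solid_seq T V \<and> x \<in> dcompl (\<Inter> (range V)))"
  by (auto simp: carrier_top_def)

text \<open>Suppose no such \<open>y\<close> exists, and take a normal sequence of order closed sets
  missing \<open>x\<close>. No element of \<open>(0, x]\<close> is disjoint from its kernel, so the
  kernel is order dense below \<open>x\<close>. Then \<open>x\<close> is a directed supremum of
  kernel elements, and order closedness puts it back into \<open>V 0\<close>.\<close>

lemma carrier_top_order_dense:
  fixes x :: "'a::archimedean_vector_lattice"
  assumes T: "fatou_topology T" and x: "0 < x"
  shows "\<exists>y\<in>carrier_top T. 0 < y \<and> y \<le> x"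
proof (rule ccontr)
  assume none: "\<not> ?thesis"
  obtain U where U: "nhd0 T U" "x \<notin> U"
    using nhd0_separates[OF fatou_linear[OF T], of x] x by auto
  obtain V where V: "normal_solid_seq T V" "\<And>n. order_closed (V n)" "\<And>n. V n \<subseteq> U"
    using fatou_normal_seq[OF T, of "\<lambda>_. U", OF U(1)] by blast
  let ?N = "\<Inter> (range V)"
  note ideal = normal_seq_Inter_ideal[OF V(1)]
  then have sol: "solid ?N" by (simp add: ideal_vl_def)
  have "\<exists>z\<in>?N. 0 < z \<and> z \<le> y" if y: "0 < y" "y \<le> x" for y
  proof -
    have "y \<notin> dcompl ?N" using none V(1) y carrier_top_iff by blast
    then obtain n where n: "n \<in> ?N" "inf (vabs y) (vabs n) \<noteq> 0" by (auto simp: dcompl_def)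
    have "inf (vabs y) (vabs n) \<in> ?N" by (rule solid_inD[OF sol n(1)]) simp
    moreover have "0 < inf (vabs y) (vabs n)" using n(2) by (simp add: order.not_eq_order_implies_strict)
    moreover have "inf (vabs y) (vabs n) \<le> y" using y by simp
    ultimately show ?thesis by blast
  qed
  then have lub: "is_lub_vl {z\<in>?N. 0 \<le> z \<and> z \<le> x} x"
    using order_dense_lub[OF ideal] x by simp
  have "x \<in> V 0"
  proof (rule order_closed_directed_lub[OF V(2) _ _ lub])
    \<comment> \<open>Directedness holds because \<open>sup a b\<close> lies below
      \<open>a + b\<close>, which is again in the kernel.\<close>
    fix a b assume ab: "a \<in> {z\<in>?N. 0 \<le> z \<and> z \<le> x}" "b \<in> {z\<in>?N. 0 \<le> z \<and> z \<le> x}"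
    then have "a + b \<in> ?N" using ideal unfolding ideal_vl_def by blast
    moreover have "0 \<le> sup a b" "sup a b \<le> a + b"
      using ab by (auto intro: add_increasing add_increasing2 le_supI1)
    ultimately have "sup a b \<in> ?N" by (rule solid_between[OF sol])
    then show "\<exists>c\<in>{z\<in>?N. 0 \<le> z \<and> z \<le> x}. a \<le> c \<and> b \<le> c"
      using ab \<open>0 \<le> sup a b\<close> by (intro bexI[of _ "sup a b"]) auto
  next
    have "0 \<in> ?N" using ideal by (simp only: ideal_vl_def)
    then have "0 \<in> {z\<in>?N. 0 \<le> z \<and> z \<le> x}" using x by simp
    then show "{z\<in>?N. 0 \<le> z \<and> z \<le> x} \<noteq> {}" by blast
  qed auto
  then show False using V(3) U(2) by blast
qed

text \<open>The bound \<open>k \<le> n\<close> makes each term a finite intersection, hence a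
  neighbourhood. It grows with \<open>n\<close>, so every sequence needed at index \<open>n\<close>
  is also present at \<open>Suc n\<close>.\<close>

lemma normal_seq_diagonal:
  assumes V: "\<And>k::nat. normal_solid_seq T (V k)"
  shows "normal_solid_seq T (\<lambda>n. \<Inter>k\<le>n. V k n)"
  unfolding normal_solid_seq_def
proof (intro allI conjI)
  fix n
  have "nhd0 T (\<Inter>k\<le>m. V k n)" for m
    by (induction m) (auto simp: atMost_Suc intro: nhd0_Int normal_seq_nhd0[OF V])
  then show "nhd0 T (\<Inter>k\<le>n. V k n)" .
  show "solid (\<Inter>k\<le>n. V k n)"
    by (intro solid_INT normal_seq_solid[OF V])
  show "set_plus_vl (\<Inter>k\<le>Suc n. V k (Suc n)) (\<Inter>k\<le>Suc n. V k (Suc n)) \<subseteq> (\<Inter>k\<le>n. V k n)"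
    unfolding set_plus_vl_subset_iff by (auto intro!: normal_seq_add[OF V])
qed

text \<open>The diagonal sequence has a kernel inside each of the individual kernels. Disjoint
  complements reverse inclusions, so a single band receives all of \<open>A\<close>.\<close>

lemma countable_subset_carrier:
  assumes T: "linear_topology_on UNIV T" and A: "countable A" "A \<subseteq> carrier_top T"
  obtains V where "normal_solid_seq T V" "A \<subseteq> dcompl (\<Inter> (range V))"
proof (cases "A = {}")
  case True
  have "normal_solid_seq T (\<lambda>_. UNIV)"
    using nhd0_UNIV[OF T] by (auto simp: normal_solid_seq_def solid_in_def)
  then show thesis using True that by blast
next
  case False
  define a where "a = from_nat_into A"
  have a: "range a = A" using False A by (simp add: a_def)
  have "\<exists>V. normal_solid_seq T V \<and> a k \<in> dcompl (\<Inter> (range V))" for k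
    using a A(2) carrier_top_iff by blast
  then obtain V where V: "\<And>k. normal_solid_seq T (V k)" "\<And>k. a k \<in> dcompl (\<Inter> (range (V k)))"
    by metis
  let ?U = "\<lambda>n. \<Inter>k\<le>n. V k n"
  have "\<Inter> (range ?U) \<subseteq> \<Inter> (range (V k))" for k
  proof
    fix y assume y: "y \<in> \<Inter> (range ?U)"
    have "y \<in> V k n" for n
    proof -
      \<comment> \<open>The diagonal intersection involves \<open>V k\<close> only from index
        \<open>k\<close> on; smaller indices follow by monotonicity.\<close>
      have "y \<in> V k (max k n)" using y by auto
      then show ?thesis using normal_seq_antimono[OF V(1), of n "max k n" k] by auto
    qed
    then show "y \<in> \<Inter> (range (V k))" by blast
  qed
  then have "dcompl (\<Inter> (range (V k))) \<subseteq> dcompl (\<Inter> (range ?U))" for k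
    by (rule dcompl_antimono)
  then have "A \<subseteq> dcompl (\<Inter> (range ?U))"
    using V(2) a by blast
  then show thesis by (rule that[OF normal_seq_diagonal[OF V(1)]])
qed

section \<open>The carrier as an ideal, and criteria for it to be the whole space\<close>

lemma carrier_top_solid: "x \<in> carrier_top T \<Longrightarrow> vabs y \<le> vabs x \<Longrightarrow> y \<in> carrier_top T"
  unfolding carrier_top_iff using solid_inD[OF solid_dcompl] by blast

lemma carrier_top_ideal:
  assumes "linear_topology_on UNIV T"
  shows "ideal_vl (carrier_top T)"
proof (rule additive_solid_ideal)
  show "0 \<in> carrier_top T"
    using countable_subset_carrier[OF assms, of "{}"] dcompl_ideal
    unfolding carrier_top_iff ideal_vl_def by (metis countable_empty empty_subsetI)
  show "solid (carrier_top T)"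
    by (rule solidI) (rule carrier_top_solid)
  fix x y assume "x \<in> carrier_top T" "y \<in> carrier_top T"
  then obtain V where "normal_solid_seq T V" "{x, y} \<subseteq> dcompl (\<Inter> (range V))"
    using countable_subset_carrier[OF assms, of "{x, y}"] by auto
  then show "x + y \<in> carrier_top T" unfolding carrier_top_iff using dcompl_add by blast
qed

text \<open>A positive \<open>x\<close> is the supremum of the carrier elements in
  \<open>[0, x]\<close>. Countably many of them already have this supremum; they lie in one band
  \<open>dcompl N\<close>, which therefore contains \<open>x\<close>.\<close>

lemma carrier_top_countable_sup:
  fixes T :: "'a::archimedean_vector_lattice topology"
  assumes T: "fatou_topology T" and csp: "countable_sup_property TYPE('a)"
  shows "carrier_top T = UNIV"
proof -
  note lin = fatou_linear[OF T]
  have "x \<in> carrier_top T" if x: "0 \<le> x" for x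
  proof -
    have "is_lub_vl {z\<in>carrier_top T. 0 \<le> z \<and> z \<le> x} x"
      by (intro order_dense_lub carrier_top_ideal[OF lin] carrier_top_order_dense[OF T] x)
    then obtain S where S: "S \<subseteq> {z\<in>carrier_top T. 0 \<le> z \<and> z \<le> x}" "countable S" "is_lub_vl S x"
      using csp unfolding countable_sup_property_def by meson
    then obtain V where V: "normal_solid_seq T V" "S \<subseteq> dcompl (\<Inter> (range V))"
      using countable_subset_carrier[OF lin] by (metis (no_types, lifting) mem_Collect_eq subset_iff)
    have "x \<in> dcompl (\<Inter> (range V))"
      using dcompl_band V(2) S(3) unfolding band_vl_def by blast
    then show ?thesis using V(1) carrier_top_iff by blast
  qed
  then have "vabs x \<in> carrier_top T" for x by simp
  then show ?thesis using carrier_top_solid[of "vabs x" T x for x] by auto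
qed

text \<open>Order density of the carrier improves the order basis condition to
  \<open>dcompl A = {0}\<close>. Since \<open>A\<close> lies in a single \<open>dcompl N\<close>,
  the kernel \<open>N\<close> lies in \<open>dcompl A\<close> and is trivial.\<close>

lemma carrier_top_countable_basis:
  fixes T :: "'a::archimedean_vector_lattice topology"
  assumes T: "fatou_topology T" and A: "countable A" "order_basis_of (carrier_top T) A"
  shows "carrier_top T = UNIV"
proof -
  have sub: "A \<subseteq> carrier_top T" and bas: "dcompl A \<inter> carrier_top T = {0}"
    using A(2) by (auto simp: order_basis_of_def)
  have A0: "dcompl A \<subseteq> {0}"
  proof
    fix x assume x: "x \<in> dcompl A"
    show "x \<in> {0}"
    proof (rule ccontr)
      assume "x \<notin> {0}"
      then have "0 < vabs x" by (simp add: order.not_eq_order_implies_strict)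
      then obtain y where y: "y \<in> carrier_top T" "0 < y" "y \<le> vabs x"
        using carrier_top_order_dense[OF T] by blast
      then have "y \<in> dcompl A" using solid_inD[OF solid_dcompl x, of y] by simp
      with y(1) bas have "y = 0" by blast
      with y(2) show False by simp
    qed
  qed
  obtain V where V: "normal_solid_seq T V" "A \<subseteq> dcompl (\<Inter> (range V))"
    using countable_subset_carrier[OF fatou_linear[OF T] A(1) sub] .
  then have "\<Inter> (range V) \<subseteq> {0}" using A0 subset_dcompl_iff by blast
  then have "x \<in> dcompl (\<Inter> (range V))" for x
    by (auto simp: dcompl_def inf_absorb2)
  then show ?thesis using V(1) carrier_top_iff by blast
qed

text \<open>A normal sequence inside the balls of radius \<open>1 / (n + 1)\<close> about zero has
  kernel \<open>{0}\<close>, and everything is disjoint from zero.\<close>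

lemma carrier_top_metrizable:
  fixes T :: "'a::vector_lattice topology"
  assumes T: "fatou_topology T" and m: "metrizable_space T"
  shows "carrier_top T = UNIV"
proof -
  note lin = fatou_linear[OF T]
  obtain M d where Md: "Metric_space M d" and Teq: "T = Metric_space.mtopology M d"
    using m by (auto simp: metrizable_space_def)
  interpret Metric_space M d by (rule Md)
  have M: "M = UNIV" using linear_topology_topspace[OF lin] by (simp add: Teq)
  have "0 \<in> M" using M by simp
  then have nhd: "nhd0 T (mball 0 (inverse (real (Suc n))))" for n
    unfolding nhd0_def Teq by (intro exI[of _ "mball 0 (inverse (real (Suc n)))"]) simp
  obtain V where V: "normal_solid_seq T V" "\<And>n. order_closed (V n)"
    "\<And>n. V n \<subseteq> mball 0 (inverse (real (Suc n)))"
    using fatou_normal_seq[OF T, of "\<lambda>n. mball 0 (inverse (real (Suc n)))", OF nhd] by blast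
  have "\<Inter> (range V) \<subseteq> {0}"
  proof
    fix x assume "x \<in> \<Inter> (range V)"
    then have "d 0 x < inverse (real (Suc n))" for n using V(3)[of n] by auto
    then have "d 0 x \<le> 0" by (meson linorder_not_le reals_Archimedean less_asym)
    then show "x \<in> {0}" using zero[of 0 x] nonneg[of 0 x] by (simp add: M)
  qed
  then have "x \<in> dcompl (\<Inter> (range V))" for x
    by (auto simp: dcompl_def inf_absorb2)
  then show ?thesis using V(1) carrier_top_iff by blast
qed

subsection \<open>Metrisation of normal sequences\<close>

text \<open>The chaining argument behind the classical metrisation theorems. The list is cut into a
  prefix, one entry and a suffix, where prefix and suffix each cost at most half of the total
  \<open>S\<close>. By induction all three pieces have \<open>f\<close>-value at most
  \<open>S\<close>, and \<open>triple\<close> combines them.\<close>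

lemma chain_bound:
  fixes f :: "'a::comm_monoid_add \<Rightarrow> real"
  assumes nonneg: "\<And>x. 0 \<le> f x" and zero: "f 0 = 0"
    and triple: "\<And>a b c e. f a \<le> e \<Longrightarrow> f b \<le> e \<Longrightarrow> f c \<le> e \<Longrightarrow> f (a + b + c) \<le> 2 * e"
  shows "f (sum_list xs) \<le> 2 * sum_list (map f xs)"
proof (induction "length xs" arbitrary: xs rule: less_induct)
  case less
  define S where "S = sum_list (map f xs)"
  have pos: "0 \<le> sum_list (map f ys)" for ys
    by (intro sum_list_nonneg) (auto simp: nonneg)
  show ?case
  proof (cases "xs = []")
    case False
    \<comment> \<open>Split at the last entry before which at most half of the total is spent.\<close>
    let ?P = "\<lambda>k. k < length xs \<and> 2 * sum_list (map f (take k xs)) \<le> S"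
    define k where "k = (GREATEST k. ?P k)"
    have P0: "?P 0" using False pos[of xs] by (simp add: S_def)
    have Pk: "?P k" unfolding k_def
      by (rule GreatestI_nat[where b = "length xs"]) (use P0 in auto)
    have split: "xs = take k xs @ xs ! k # drop (Suc k) xs"
      using Pk id_take_nth_drop by blast
    have S: "S = sum_list (map f (take k xs)) + f (xs ! k) + sum_list (map f (drop (Suc k) xs))"
      unfolding S_def by (subst split) (simp add: add.assoc)
    have drop: "2 * sum_list (map f (drop (Suc k) xs)) \<le> S"
    proof (cases "Suc k < length xs")
      case True
      have "\<not> ?P (Suc k)"
      proof
        assume "?P (Suc k)"
        then have "Suc k \<le> k" unfolding k_def by (intro Greatest_le_nat[where b = "length xs"]) auto
        then show False by simp
      qed
      then have "S < 2 * sum_list (map f (take (Suc k) xs))" using True by auto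
      also have "sum_list (map f (take (Suc k) xs)) = sum_list (map f (take k xs)) + f (xs ! k)"
        using Pk by (simp add: take_Suc_conv_app_nth)
      finally show ?thesis using S by simp
    qed (use pos[of xs] in \<open>simp add: S_def\<close>)
    have "f (sum_list (take k xs)) \<le> S"
      using less[of "take k xs"] Pk by simp
    moreover have "f (sum_list (drop (Suc k) xs)) \<le> S"
      using less[of "drop (Suc k) xs"] drop False by simp
    moreover have "f (xs ! k) \<le> S"
      using S pos[of "take k xs"] pos[of "drop (Suc k) xs"] by simp
    ultimately have "f (sum_list (take k xs) + xs ! k + sum_list (drop (Suc k) xs)) \<le> 2 * S"
      by (intro triple)
    moreover have "sum_list xs = sum_list (take k xs) + xs ! k + sum_list (drop (Suc k) xs)"
      by (subst split) (simp add: add.assoc)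
    ultimately show ?thesis by (simp add: S_def)
  qed (simp add: zero)
qed

text \<open>The gauge \<open>f\<close> records in powers of \<open>1/2\<close> the first index at
  which a point leaves the sequence, but it need not be subadditive. Its infimum over all finite
  decompositions, \<open>\<rho>\<close>, is subadditive, and \<open>chain_bound\<close> gives
  \<open>f / 2 \<le> \<rho> \<le> f\<close>. The factor \<open>2\<close> is the shift from
  \<open>n\<close> to \<open>Suc n\<close> in the last conclusion.\<close>

lemma balanced_seq_pseudonorm:
  fixes W :: "nat \<Rightarrow> 'a::real_vector set"
  assumes zero: "\<And>n. 0 \<in> W n"
    and bal: "\<And>n x c. x \<in> W n \<Longrightarrow> \<bar>c\<bar> \<le> 1 \<Longrightarrow> c *\<^sub>R x \<in> W n"
    and triple: "\<And>n a b c. a \<in> W (Suc n) \<Longrightarrow> b \<in> W (Suc n) \<Longrightarrow> c \<in> W (Suc n) \<Longrightarrow> a + b + c \<in> W n"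
  obtains \<rho> :: "'a \<Rightarrow> real" where
    "\<And>x. 0 \<le> \<rho> x" "\<rho> 0 = 0" "\<And>x y. \<rho> (x + y) \<le> \<rho> x + \<rho> y"
    "\<And>c x. \<bar>c\<bar> \<le> 1 \<Longrightarrow> \<rho> (c *\<^sub>R x) \<le> \<rho> x"
    "\<And>n x. x \<in> W n \<Longrightarrow> \<rho> x < (1/2)^n"
    "\<And>n x. \<rho> x < (1/2)^Suc n \<Longrightarrow> x \<in> W n"
proof -
  define f :: "'a \<Rightarrow> real" where
    "f y = (if \<forall>n. y \<in> W n then 0 else (1/2)^(LEAST n. y \<notin> W n))" for y
  have anti: "W n \<subseteq> W m" if "m \<le> n" for m n
  proof (rule lift_Suc_antimono_le[OF _ that])
    fix k show "W (Suc k) \<subseteq> W k" using triple[of _ k 0 0] zero by auto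
  qed
  have f_iff: "f y < (1/2)^n \<longleftrightarrow> y \<in> W n" for y n
  proof (cases "\<forall>n. y \<in> W n")
    case False
    define k where "k = (LEAST n. y \<notin> W n)"
    have k: "y \<notin> W k" unfolding k_def using False by (metis (mono_tags) LeastI)
    have "y \<in> W n \<longleftrightarrow> n < k"
      using k anti[of k n] not_less_Least[of n "\<lambda>n. y \<notin> W n"] unfolding k_def by force
    moreover have "f y = (1/2)^k" using False by (simp add: f_def k_def)
    ultimately show ?thesis by (simp add: power_strict_decreasing_iff)
  qed (simp add: f_def)
  have f0: "f 0 = 0" using zero by (simp add: f_def)
  have fpos: "0 \<le> f y" for y by (simp add: f_def)
  have fval: "f y = 0 \<or> (\<exists>k. f y = (1/2)^k)" for y by (auto simp: f_def)
  have ftriple: "f (a + b + c) \<le> 2 * e" if "f a \<le> e" "f b \<le> e" "f c \<le> e" for a b c e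
  proof (rule ccontr)
    assume neg: "\<not> f (a + b + c) \<le> 2 * e"
    have "0 \<le> e" using that fpos[of a] by linarith
    with neg fval[of "a + b + c"] obtain k where k: "f (a + b + c) = (1/2)^k" by force
    \<comment> \<open>Being below this power of \<open>1/2\<close> means lying in
      \<open>W (Suc k)\<close>, so all three summands do, and their sum would be in
      \<open>W k\<close>.\<close>
    then have "e < (1/2)^Suc k" using neg by simp
    then have "a + b + c \<in> W k" using that by (intro triple) (auto simp flip: f_iff)
    then show False using f_iff[of "a + b + c" k] k by simp
  qed
  have fbal: "f (c *\<^sub>R x) \<le> f x" if "\<bar>c\<bar> \<le> 1" for c x
  proof (rule ccontr)
    assume neg: "\<not> f (c *\<^sub>R x) \<le> f x"
    then obtain k where k: "f (c *\<^sub>R x) = (1/2)^k" using fval[of "c *\<^sub>R x"] fpos[of x] by force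
    then have "x \<in> W k" using neg by (simp flip: f_iff)
    then have "c *\<^sub>R x \<in> W k" using bal that by blast
    then show False using f_iff[of "c *\<^sub>R x" k] k by simp
  qed
  \<comment> \<open>The costs of all ways to write \<open>y\<close> as a finite sum.\<close>
  define R where "R y = {sum_list (map f xs) | xs. sum_list xs = y}" for y
  define \<rho> where "\<rho> y = Inf (R y)" for y
  have Rpos: "0 \<le> r" if "r \<in> R y" for r y
    using that unfolding R_def by (auto intro!: sum_list_nonneg simp: fpos)
  have bdd: "bdd_below (R y)" for y by (rule bdd_belowI[of _ 0]) (rule Rpos)
  have fR: "f y \<in> R y" for y unfolding R_def by (auto intro!: exI[of _ "[y]"])
  have ne: "R y \<noteq> {}" for y using fR by blast
  have \<rho>_le: "\<rho> y \<le> r" if "r \<in> R y" for r y unfolding \<rho>_def using that bdd by (rule cInf_lower)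
  have le_\<rho>: "r \<le> \<rho> y" if "\<And>s. s \<in> R y \<Longrightarrow> r \<le> s" for r y
    unfolding \<rho>_def using ne that by (rule cInf_greatest)
  have \<rho>_f: "\<rho> y \<le> f y" for y using fR by (rule \<rho>_le)
  have f_\<rho>: "f y / 2 \<le> \<rho> y" for y
  proof (rule le_\<rho>)
    fix s assume "s \<in> R y"
    then obtain xs where "s = sum_list (map f xs)" "sum_list xs = y" by (auto simp: R_def)
    then show "f y / 2 \<le> s" using chain_bound[of f xs, OF fpos f0 ftriple] by simp
  qed
  show thesis
  proof (rule that[of \<rho>])
    show pos: "0 \<le> \<rho> x" for x using Rpos by (rule le_\<rho>)
    show "\<rho> 0 = 0" using \<rho>_f[of 0] pos[of 0] f0 by simp
    show "\<rho> (x + y) \<le> \<rho> x + \<rho> y" for x y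
    proof -
      have add: "s + t \<in> R (x + y)" if st: "s \<in> R x" "t \<in> R y" for s t
      proof -
        obtain xs ys where "s = sum_list (map f xs)" "sum_list xs = x"
          "t = sum_list (map f ys)" "sum_list ys = y" using st unfolding R_def by blast
        then show ?thesis unfolding R_def by (intro CollectI exI[of _ "xs @ ys"]) auto
      qed
      have "\<rho> (x + y) - t \<le> \<rho> x" if "t \<in> R y" for t
        using \<rho>_le[OF add] that by (intro le_\<rho>) (auto simp: algebra_simps)
      then have "\<rho> (x + y) - \<rho> x \<le> \<rho> y" by (intro le_\<rho>) (auto simp: algebra_simps)
      then show ?thesis by simp
    qed
    show "\<rho> (c *\<^sub>R x) \<le> \<rho> x" if c: "\<bar>c\<bar> \<le> 1" for c x
    proof (rule le_\<rho>)
      fix s assume "s \<in> R x"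
      then obtain xs where xs: "s = sum_list (map f xs)" "sum_list xs = x" by (auto simp: R_def)
      have "sum_list (map (\<lambda>u. c *\<^sub>R u) xs) = c *\<^sub>R sum_list xs"
        by (induction xs) (auto simp: scaleR_add_right)
      then have "sum_list (map f (map (\<lambda>u. c *\<^sub>R u) xs)) \<in> R (c *\<^sub>R x)"
        unfolding R_def using xs by blast
      then have "\<rho> (c *\<^sub>R x) \<le> sum_list (map f (map (\<lambda>u. c *\<^sub>R u) xs))" by (rule \<rho>_le)
      also have "\<dots> \<le> s" unfolding xs by (simp add: o_def) (intro sum_list_mono fbal c)
      finally show "\<rho> (c *\<^sub>R x) \<le> s" .
    qed
    show "\<rho> x < (1/2)^n" if "x \<in> W n" for x n
      using that \<rho>_f[of x] f_iff[of x n] by linarith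
    show "x \<in> W n" if "\<rho> x < (1/2)^Suc n" for x n
      using that f_\<rho>[of x] by (simp flip: f_iff)
  qed
qed

text \<open>Addition is continuous by subadditivity. For scalar multiplication,
  \<open>absorb\<close> controls a change of the scalar at a fixed vector, and \<open>mult\<close> a
  change of the vector at bounded scalars.\<close>

lemma pseudonorm_linear_topology:
  fixes \<rho> :: "'a::vector_lattice \<Rightarrow> real"
  assumes pos: "\<And>x. 0 \<le> \<rho> x" and null: "\<rho> 0 = 0" and add: "\<And>x y. \<rho> (x + y) \<le> \<rho> x + \<rho> y"
    and bal: "\<And>c x. \<bar>c\<bar> \<le> 1 \<Longrightarrow> \<rho> (c *\<^sub>R x) \<le> \<rho> x"
    and B: "subspace B" and sep: "\<And>x. x \<in> B \<Longrightarrow> \<rho> x = 0 \<Longrightarrow> x = 0"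
    and absorb: "\<And>x \<epsilon>. x \<in> B \<Longrightarrow> \<epsilon> > 0 \<Longrightarrow> \<exists>\<delta>>0. \<forall>c. \<bar>c\<bar> < \<delta> \<longrightarrow> \<rho> (c *\<^sub>R x) < \<epsilon>"
  shows "Metric_space B (\<lambda>x y. \<rho> (x - y))"
    and "linear_topology_on B (Metric_space.mtopology B (\<lambda>x y. \<rho> (x - y)))"
proof -
  have minus: "\<rho> (- x) = \<rho> x" for x
    using bal[of "- 1" x] bal[of "- 1" "- x"] by simp
  have commute: "\<rho> (x - y) = \<rho> (y - x)" for x y
    using minus[of "x - y"] by simp
  show MS: "Metric_space B (\<lambda>x y. \<rho> (x - y))"
  proof
    show "\<rho> (x - y) = 0 \<longleftrightarrow> x = y" if "x \<in> B" "y \<in> B" for x y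
      using sep[OF subspace_diff[OF B that]] null by auto
    show "\<rho> (x - z) \<le> \<rho> (x - y) + \<rho> (y - z)" for x y z
      using add[of "x - y" "y - z"] by simp
  qed (rule pos commute)+
  interpret Metric_space B "\<lambda>x y. \<rho> (x - y)" by (rule MS)
  have nat_mult: "\<rho> (real n *\<^sub>R x) \<le> real n * \<rho> x" for n x
  proof (induction n)
    case (Suc n)
    have "\<rho> (real (Suc n) *\<^sub>R x) \<le> \<rho> x + \<rho> (real n *\<^sub>R x)"
      using add[of x "real n *\<^sub>R x"] by (simp add: scaleR_add_left)
    then show ?case using Suc by (simp add: algebra_simps)
  qed (simp add: null)
  \<comment> \<open>Since \<open>\<rho>\<close> need not be homogeneous,
    \<open>\<bar>c\<bar>\<close> is rounded up to a natural number, which costs the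
    \<open>+ 1\<close>.\<close>
  have mult: "\<rho> (c *\<^sub>R x) \<le> (\<bar>c\<bar> + 1) * \<rho> x" for c x
  proof -
    define n where "n = nat \<lceil>\<bar>c\<bar>\<rceil>"
    have n: "\<bar>c\<bar> \<le> real n" "real n \<le> \<bar>c\<bar> + 1" unfolding n_def by linarith+
    have "\<rho> (c *\<^sub>R x) \<le> \<rho> (real n *\<^sub>R x)"
    proof (cases "n = 0")
      case False
      then have "c *\<^sub>R x = (c / real n) *\<^sub>R (real n *\<^sub>R x)" by simp
      moreover have "\<bar>c / real n\<bar> \<le> 1" using n False by (simp add: abs_divide divide_le_eq)
      ultimately show ?thesis by (metis bal)
    qed (use n in simp)
    also have "\<dots> \<le> real n * \<rho> x" by (rule nat_mult)
    also have "\<dots> \<le> (\<bar>c\<bar> + 1) * \<rho> x" using n pos by (intro mult_right_mono)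
    finally show ?thesis .
  qed
  have plus: "continuous_map (prod_topology mtopology mtopology) mtopology (\<lambda>(x, y). x + y)"
    unfolding continuous_map_to_metric
  proof (intro ballI allI impI)
    fix p and \<epsilon> :: real assume "p \<in> topspace (prod_topology mtopology mtopology)" and e: "\<epsilon> > 0"
    then obtain x y where p: "p = (x, y)" "x \<in> B" "y \<in> B" by auto
    let ?U = "mball x (\<epsilon>/2) \<times> mball y (\<epsilon>/2)"
    have "x' + y' \<in> mball (x + y) \<epsilon>" if "(x', y') \<in> ?U" for x' y'
    proof -
      have "\<rho> ((x + y) - (x' + y')) \<le> \<rho> (x - x') + \<rho> (y - y')"
        using add[of "x - x'" "y - y'"] by (simp add: algebra_simps)
      with that p subspace_add[OF B] show ?thesis by auto
    qed
    moreover have "openin (prod_topology mtopology mtopology) ?U"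
      by (simp add: openin_prod_Times_iff)
    ultimately show "\<exists>U. openin (prod_topology mtopology mtopology) U \<and> p \<in> U \<and>
        (\<forall>q\<in>U. (case q of (x, y) \<Rightarrow> x + y) \<in> mball (case p of (x, y) \<Rightarrow> x + y) \<epsilon>)"
      using p e null by (intro exI[of _ ?U]) auto
  qed
  have scale: "continuous_map (prod_topology euclideanreal mtopology) mtopology (\<lambda>(c, x). c *\<^sub>R x)"
    unfolding continuous_map_to_metric
  proof (intro ballI allI impI)
    fix p and \<epsilon> :: real assume "p \<in> topspace (prod_topology euclideanreal mtopology)" and e: "\<epsilon> > 0"
    then obtain c x where p: "p = (c, x)" "x \<in> B" by auto
    obtain \<delta> where d: "\<delta> > 0" "\<And>b. \<bar>b\<bar> < \<delta> \<Longrightarrow> \<rho> (b *\<^sub>R x) < \<epsilon> / 2"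
      using absorb[OF p(2), of "\<epsilon>/2"] e by auto
    \<comment> \<open>For \<open>\<bar>c - c'\<bar> < 1\<close> the factor
      \<open>\<bar>c'\<bar> + 1\<close> from \<open>mult\<close> is at most
      \<open>\<bar>c\<bar> + 2\<close>, so this radius bounds the second error by
      \<open>\<epsilon> / 2\<close>.\<close>
    let ?\<eta> = "\<epsilon> / (2 * (\<bar>c\<bar> + 2))"
    let ?U = "ball c (min \<delta> 1) \<times> mball x ?\<eta>"
    have "c' *\<^sub>R x' \<in> mball (c *\<^sub>R x) \<epsilon>" if "(c', x') \<in> ?U" for c' x'
    proof -
      have c': "\<bar>c - c'\<bar> < \<delta>" "\<bar>c - c'\<bar> < 1" and x': "x' \<in> B" "\<rho> (x - x') < ?\<eta>"
        using that by (auto simp: dist_real_def)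
      have "c *\<^sub>R x - c' *\<^sub>R x' = (c - c') *\<^sub>R x + c' *\<^sub>R (x - x')" by (simp add: algebra_simps)
      then have "\<rho> (c *\<^sub>R x - c' *\<^sub>R x') \<le> \<rho> ((c - c') *\<^sub>R x) + (\<bar>c'\<bar> + 1) * \<rho> (x - x')"
        using add mult by (metis add_left_mono order_trans)
      also have "(\<bar>c'\<bar> + 1) * \<rho> (x - x') \<le> (\<bar>c\<bar> + 2) * ?\<eta>"
        using c' x' pos by (intro mult_mono) auto
      also have "\<dots> = \<epsilon> / 2" by (simp add: divide_simps)
      also have "\<rho> ((c - c') *\<^sub>R x) < \<epsilon> / 2" using d c' by simp
      finally show ?thesis using p x' subspace_scale[OF B] by simp
    qed
    moreover have "openin (prod_topology euclideanreal mtopology) ?U"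
      by (simp add: openin_prod_Times_iff)
    ultimately show "\<exists>U. openin (prod_topology euclideanreal mtopology) U \<and> p \<in> U \<and>
        (\<forall>q\<in>U. (case q of (c, x) \<Rightarrow> c *\<^sub>R x) \<in> mball (case p of (c, x) \<Rightarrow> c *\<^sub>R x) \<epsilon>)"
      using p e d null by (intro exI[of _ ?U]) auto
  qed
  show "linear_topology_on B mtopology"
    unfolding linear_topology_on_def using plus scale Hausdorff_space_mtopology by simp
qed

text \<open>The pseudonorm of the sequence becomes a norm-like distance on \<open>B\<close>, where
  the kernel is trivial by \<open>sep\<close>. The last two conclusions say that the traces of the
  \<open>W n\<close> on \<open>B\<close> form a base at zero and, by translation, everywhere, so
  Cauchy sequences and limits can be tested on the \<open>W n\<close>.\<close>

lemma normal_seq_metrizable_topology: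
  fixes T :: "'a::vector_lattice topology"
  assumes T: "linear_topology_on UNIV T" and W: "normal_solid_seq T W"
    and B: "ideal_vl B" and sep: "\<And>y. y \<in> B \<Longrightarrow> (\<And>n. y \<in> W n) \<Longrightarrow> y = 0"
  obtains \<sigma> where "locally_solid_on B \<sigma>" "metrizable_space \<sigma>"
    "\<And>U. openin \<sigma> U \<Longrightarrow> openin (subtopology T B) U"
    "\<And>n. nhd0 \<sigma> (W n \<inter> B)"
    "\<And>U y. openin \<sigma> U \<Longrightarrow> y \<in> U \<Longrightarrow> \<exists>n. \<forall>z\<in>B. z - y \<in> W n \<longrightarrow> z \<in> U"
proof -
  note sol = normal_seq_solid[OF W] and anti = normal_seq_antimono[OF W]
  have zero_W: "0 \<in> W n" for n by (rule nhd0_zero[OF normal_seq_nhd0[OF W]])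
  \<comment> \<open>Every second term, because the pseudonorm needs sums of three elements.\<close>
  have triple: "a + b + c \<in> W (2 * n)"
    if "a \<in> W (2 * Suc n)" "b \<in> W (2 * Suc n)" "c \<in> W (2 * Suc n)" for a b c n
  proof -
    have "a + b \<in> W (Suc (2 * n))" using that by (intro normal_seq_add[OF W]) simp_all
    moreover have "c \<in> W (Suc (2 * n))" using that anti[of "Suc (2 * n)" "2 * Suc n"] by auto
    ultimately show ?thesis by (rule normal_seq_add[OF W])
  qed
  obtain \<rho> :: "'a \<Rightarrow> real" where \<rho>: "\<And>x. 0 \<le> \<rho> x" "\<rho> 0 = 0" "\<And>x y. \<rho> (x + y) \<le> \<rho> x + \<rho> y"
    "\<And>c x. \<bar>c\<bar> \<le> 1 \<Longrightarrow> \<rho> (c *\<^sub>R x) \<le> \<rho> x"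
    and \<rho>_less: "\<And>n x. x \<in> W (2 * n) \<Longrightarrow> \<rho> x < (1/2)^n"
    and \<rho>_mem: "\<And>n x. \<rho> x < (1/2)^Suc n \<Longrightarrow> x \<in> W (2 * n)"
    by (rule balanced_seq_pseudonorm[of "\<lambda>n. W (2 * n)"])
      (use zero_W solid_scaleR[OF sol] triple in blast)+
  have mem_W: "x \<in> W n" if "\<rho> x < (1/2)^Suc n" for x n
    using \<rho>_mem[OF that] anti[of n "2 * n"] by auto
  have subsp: "subspace B" using B by (simp add: ideal_vl_def subspace_def)
  have half: "\<exists>n. (1/2)^n < \<epsilon>" if "\<epsilon> > 0" for \<epsilon> :: real
    using real_arch_pow_inv[OF that] by simp
  have sep\<rho>: "x = 0" if "x \<in> B" "\<rho> x = 0" for x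
    using that by (intro sep mem_W) auto
  have absorb: "\<exists>\<delta>>0. \<forall>c. \<bar>c\<bar> < \<delta> \<longrightarrow> \<rho> (c *\<^sub>R x) < \<epsilon>" if "\<epsilon> > 0" for x \<epsilon>
  proof -
    obtain n where n: "(1/2)^n < \<epsilon>" using half[OF \<open>\<epsilon> > 0\<close>] by blast
    obtain \<delta> where "\<delta> > 0" "\<And>c. \<bar>c\<bar> < \<delta> \<Longrightarrow> c *\<^sub>R x \<in> W (2 * n)"
      using nhd0_absorbing[OF T normal_seq_nhd0[OF W]] by metis
    then show ?thesis using \<rho>_less n by (meson order_less_trans)
  qed
  note topo = pseudonorm_linear_topology[OF \<rho> subsp sep\<rho> absorb]
  interpret Metric_space B "\<lambda>x y. \<rho> (x - y)" by (rule topo(1))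
  have B0: "0 \<in> B" using B by (simp add: ideal_vl_def)
  have nhd: "nhd0 mtopology (W n \<inter> B)" for n
    unfolding nhd0_def
  proof (intro exI conjI)
    show "mball 0 ((1/2)^Suc n) \<subseteq> W n \<inter> B"
    proof
      fix y assume "y \<in> mball 0 ((1/2)^Suc n)"
      then have "- y \<in> W n" "y \<in> B" using mem_W[of "- y" n] by auto
      then show "y \<in> W n \<inter> B" using solid_minus[OF sol, of "- y" n] by simp
    qed
  qed (use B0 \<rho>(2) in auto)
  have base: "\<exists>n. \<forall>z\<in>B. z - y \<in> W n \<longrightarrow> z \<in> U" if U: "openin mtopology U" "y \<in> U" for U y
  proof -
    obtain r where r: "r > 0" "mball y r \<subseteq> U" using U by (auto simp: openin_mtopology)
    obtain n where n: "(1/2)^n < r" using half[OF r(1)] by blast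
    have "y \<in> B" using U openin_subset by fastforce
    have "z \<in> U" if z: "z \<in> B" "z - y \<in> W (2 * n)" for z
    proof -
      have "y - z \<in> W (2 * n)" using solid_minus[OF sol z(2)] by simp
      then have "\<rho> (y - z) < r" using \<rho>_less n by (meson order_less_trans)
      then show ?thesis using r(2) z \<open>y \<in> B\<close> by auto
    qed
    then show ?thesis by blast
  qed
  show thesis
  proof (rule that[of mtopology])
    show "locally_solid_on B mtopology"
      unfolding locally_solid_on_def
    proof (intro conjI allI impI topo(2))
      fix U assume "nhd0 mtopology U"
      then obtain U' where U': "openin mtopology U'" "0 \<in> U'" "U' \<subseteq> U" by (auto simp: nhd0_def)
      then obtain n where "\<forall>z\<in>B. z - 0 \<in> W n \<longrightarrow> z \<in> U'" using base by blast
      then have "W n \<inter> B \<subseteq> U" using U'(3) by auto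
      moreover have "solid_in B (W n \<inter> B)"
        using sol[of n] unfolding solid_in_def by blast
      ultimately show "\<exists>V. nhd0 mtopology V \<and> solid_in B V \<and> V \<subseteq> U" using nhd by blast
    qed
    show "openin (subtopology T B) U" if U: "openin mtopology U" for U
      unfolding openin_subopen[of _ U]
    proof
      fix y assume y: "y \<in> U"
      obtain n where n: "\<forall>z\<in>B. z - y \<in> W n \<longrightarrow> z \<in> U" using base[OF U y] by blast
      obtain V where V: "openin T V" "y \<in> V" "\<And>z. z \<in> V \<Longrightarrow> z - y \<in> W n"
        using nhd0_translate[OF T normal_seq_nhd0[OF W]] by metis
      have "U \<subseteq> B" using openin_subset[OF U] by simp
      with n V y show "\<exists>V. openin (subtopology T B) V \<and> y \<in> V \<and> V \<subseteq> U"
        by (intro exI[of _ "V \<inter> B"]) (auto simp: openin_subtopology_Int)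
    qed
  qed (fact metrizable_space_mtopology nhd base)+
qed

subsection \<open>Completeness of order intervals\<close>

lemma is_lub_upper: "is_lub_vl S s \<Longrightarrow> x \<in> S \<Longrightarrow> x \<le> s"
  and is_lub_least: "is_lub_vl S s \<Longrightarrow> (\<And>x. x \<in> S \<Longrightarrow> x \<le> u) \<Longrightarrow> s \<le> u"
  by (auto simp: is_lub_vl_def)

text \<open>The limit is the infimum of the tail suprema \<open>t n\<close>. Order closedness is
  used twice: to pass from finite stages to \<open>t n - s n\<close>, and then from
  \<open>s (Suc i) - t m\<close> to the limit as \<open>m\<close> grows.\<close>

lemma fatou_summable_limit:
  fixes s :: "nat \<Rightarrow> 'a::vector_lattice"
  assumes dc: "dedekind_complete TYPE('a)" and W: "normal_solid_seq T W" and cl: "\<And>n. order_closed (W n)"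
    and s: "\<And>k. 0 \<le> s k" "\<And>k. s k \<le> x" and step: "\<And>k. s (Suc k) - s k \<in> W (Suc k)"
  obtains l where "0 \<le> l" "l \<le> x" "\<And>i. s (Suc i) - l \<in> W i"
proof -
  note sol = normal_seq_solid[OF W]
  have ex: "\<exists>t. is_lub_vl S t" if "S \<noteq> {}" "\<And>y. y \<in> S \<Longrightarrow> y \<le> u" for S and u :: 'a
    using dc that unfolding dedekind_complete_def by blast
  \<comment> \<open>The variation of \<open>s\<close> over \<open>m\<close> steps from index
    \<open>n\<close>. Peeling off its first term leaves a variation starting at
    \<open>Suc n\<close>, so normality keeps every \<open>D n m\<close> inside
    \<open>W n\<close>.\<close>
  define D where "D n m = (\<Sum>k<m. vabs (s (Suc (n + k)) - s (n + k)))" for n m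
  have D_W: "D n m \<in> W n" for n m
  proof (induction m arbitrary: n)
    case 0
    show ?case using nhd0_zero[OF normal_seq_nhd0[OF W]] by (simp add: D_def)
  next
    case (Suc m)
    have "D n (Suc m) = vabs (s (Suc n) - s n) + D (Suc n) m"
      unfolding D_def by (subst sum.lessThan_Suc_shift) simp
    moreover have "vabs (s (Suc n) - s n) \<in> W (Suc n)"
      by (rule solid_inD[OF sol step[of n]]) simp
    ultimately show ?case using normal_seq_add[OF W _ Suc.IH[of "Suc n"]] by simp
  qed
  have D_mono: "D n i \<le> D n j" if "i \<le> j" for n i j
    unfolding D_def using that by (intro sum_mono2) auto
  have D_abs: "vabs (s (n + m) - s n) \<le> D n m" for n m
  proof (induction m)
    case (Suc m)
    have "vabs (s (n + Suc m) - s n) \<le> vabs (s (n + Suc m) - s (n + m)) + vabs (s (n + m) - s n)"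
      using vabs_triangle[of "s (n + Suc m) - s (n + m)" "s (n + m) - s n"] by simp
    also have "\<dots> \<le> vabs (s (n + Suc m) - s (n + m)) + D n m"
      using Suc by (rule add_left_mono)
    finally show ?case by (simp add: D_def add.commute)
  qed (simp add: D_def)
  have "\<exists>t. is_lub_vl (s ` {n..}) t" for n using s(2) by (intro ex[of _ x]) auto
  then obtain t where t: "\<And>n. is_lub_vl (s ` {n..}) (t n)" by metis
  have s_le_t: "s k \<le> t n" if "n \<le> k" for n k using that by (intro is_lub_upper[OF t]) auto
  have t_anti: "t m \<le> t n" if "n \<le> m" for n m
    using that s_le_t by (intro is_lub_least[OF t[of m]]) auto
  have t_W: "t n - s n \<in> W n" for n
  proof (rule order_closed_directed_lub[OF cl])
    \<comment> \<open>Replaces the finite suprema of the \<open>s k - s n\<close>, whose size is controlled by \<open>D n m\<close>.\<close>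
    let ?S = "{u. 0 \<le> u \<and> (\<exists>m. u \<le> D n m) \<and> u \<le> t n - s n}"
    have nonneg: "0 \<le> t n - s n" using s_le_t[of n n] by simp
    have "0 \<in> ?S" using nonneg by (auto intro!: exI[of _ 0] simp: D_def)
    then show "?S \<noteq> {}" by blast
    show "?S \<subseteq> W n" using solid_between[OF sol D_W] by blast
    show "is_lub_vl ?S (t n - s n)"
      unfolding is_lub_vl_def
    proof (intro conjI allI impI ballI)
      fix w assume w: "\<forall>u\<in>?S. u \<le> w"
      have "s k \<le> w + s n" if "n \<le> k" for k
      proof -
        obtain m where k: "k = n + m" using \<open>n \<le> k\<close> le_Suc_ex by blast
        have "0 \<le> D n m" unfolding D_def by (intro sum_nonneg) simp
        then have "sup (s k - s n) 0 \<le> D n m"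
          using D_abs[of n m] vabs_ge_self[of "s k - s n"] k by (auto intro: order_trans)
        moreover have "sup (s k - s n) 0 \<le> t n - s n"
          using s_le_t[OF that] nonneg by (auto intro: diff_right_mono)
        ultimately have "sup (s k - s n) 0 \<in> ?S" by auto
        with w have "sup (s k - s n) 0 \<le> w" by blast
        then have "s k - s n \<le> w" by simp
        then show ?thesis by (simp only: diff_le_eq)
      qed
      then have "t n \<le> w + s n" by (intro is_lub_least[OF t[of n]]) auto
      then show "t n - s n \<le> w" by (simp only: diff_le_eq)
    qed auto
    fix a b assume ab: "a \<in> ?S" "b \<in> ?S"
    then obtain i j where "a \<le> D n i" "b \<le> D n j" by blast
    then have "sup a b \<le> D n (max i j)"
      using D_mono[of i "max i j" n] D_mono[of j "max i j" n] by (auto intro: order_trans)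
    then show "\<exists>c\<in>?S. a \<le> c \<and> b \<le> c"
      using ab by (intro bexI[of _ "sup a b"]) (auto intro: le_supI1)
  qed
  have t_pos: "0 \<le> t n" for n using s(1)[of n] s_le_t[of n n] by simp
  \<comment> \<open>The infimum of the \<open>t n\<close> is expressed as a supremum of negatives;
    the desired limit is therefore \<open>- l\<close>.\<close>
  then have "\<exists>l. is_lub_vl (range (\<lambda>n. - t n)) l" by (intro ex[of _ 0]) auto
  then obtain l where l: "is_lub_vl (range (\<lambda>n. - t n)) l" by blast
  have l_t: "- t n \<le> l" for n using is_lub_upper[OF l] by blast
  show thesis
  proof (rule that[of "- l"])
    have "l \<le> 0" using t_pos by (intro is_lub_least[OF l]) auto
    then show "0 \<le> - l" by simp
    have "t 0 \<le> x" using s(2) by (intro is_lub_least[OF t[of 0]]) auto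
    moreover have "- l \<le> t 0" using l_t[of 0] by (simp add: minus_le_iff)
    ultimately show "- l \<le> x" by simp
    fix i
    show "s (Suc i) - - l \<in> W i"
    proof (rule order_closed_directed_lub[OF cl])
      let ?S = "(\<lambda>m. s (Suc i) - t m) ` {Suc i..}"
      show "?S \<noteq> {}" by simp
      show "?S \<subseteq> W i"
      proof safe
        fix m assume m: "m \<ge> Suc i"
        then obtain k where k: "m = Suc i + k" using le_Suc_ex by blast
        \<comment> \<open>Both this difference and \<open>t m - s m\<close> are small of order
          \<open>Suc i\<close>; adding them costs one index, hence \<open>W i\<close>.\<close>
        have "s (Suc i) - s m \<in> W (Suc i)"
          by (rule solid_inD[OF sol D_W[of "Suc i" k]])
            (use D_abs[of "Suc i" k] vabs_minus[of "s m - s (Suc i)"] k vabs_ge_self order_trans in fastforce)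
        moreover have "- (t m - s m) \<in> W (Suc i)"
          using solid_minus[OF sol t_W[of m]] normal_seq_antimono[OF W m] by blast
        ultimately have "(s (Suc i) - s m) + - (t m - s m) \<in> W i" by (rule normal_seq_add[OF W])
        then show "s (Suc i) - t m \<in> W i" by simp
      qed
      show "is_lub_vl ?S (s (Suc i) - - l)"
        unfolding is_lub_vl_def
      proof (intro conjI allI impI ballI)
        fix y assume "y \<in> ?S"
        then obtain m where "y = s (Suc i) + - t m" by auto
        then show "y \<le> s (Suc i) - - l" using l_t[of m] by (simp only: diff_minus_eq_add add_left_mono)
      next
        fix w assume w: "\<forall>y\<in>?S. y \<le> w"
        have "- t m \<le> w - s (Suc i)" for m
        proof -
          \<comment> \<open>The set \<open>?S\<close> contains only indices from
            \<open>Suc i\<close> on, whereas \<open>l\<close> bounds all \<open>- t m\<close>;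
            smaller \<open>m\<close> are covered because \<open>t\<close> decreases.\<close>
          have "s (Suc i) - t (max m (Suc i)) \<le> w" using w by auto
          moreover have "s (Suc i) - t m \<le> s (Suc i) - t (max m (Suc i))"
            by (intro diff_left_mono t_anti) simp
          ultimately have "s (Suc i) - t m \<le> w" by (rule order_trans[rotated])
          then show ?thesis by (simp add: algebra_simps)
        qed
        then have "l \<le> w - s (Suc i)" by (intro is_lub_least[OF l]) auto
        then show "s (Suc i) - - l \<le> w" by (simp add: algebra_simps)
      qed
      fix a b assume "a \<in> ?S" "b \<in> ?S"
      then obtain m n where mn: "m \<ge> Suc i" "n \<ge> Suc i" "a = s (Suc i) - t m" "b = s (Suc i) - t n" by auto
      then show "\<exists>c\<in>?S. a \<le> c \<and> b \<le> c"
        by (intro bexI[of _ "s (Suc i) - t (max m n)"]) (auto intro!: diff_left_mono t_anti)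
    qed
  qed
qed

text \<open>A rapidly converging subsequence has a limit by \<open>fatou_summable_limit\<close>, and
  the Cauchy condition carries this limit over to the whole sequence.\<close>

lemma fatou_cauchy_limit:
  fixes q :: "nat \<Rightarrow> 'a::vector_lattice"
  assumes dc: "dedekind_complete TYPE('a)" and W: "normal_solid_seq T W" and cl: "\<And>n. order_closed (W n)"
    and q: "\<And>k. 0 \<le> q k" "\<And>k. q k \<le> x"
    and cauchy: "\<And>n. \<exists>N. \<forall>m\<ge>N. \<forall>k\<ge>N. q m - q k \<in> W n"
  shows "\<exists>l. 0 \<le> l \<and> l \<le> x \<and> (\<forall>n. \<exists>N. \<forall>m\<ge>N. q m - l \<in> W n)"
proof -
  obtain N where N: "\<And>n m k. m \<ge> N n \<Longrightarrow> k \<ge> N n \<Longrightarrow> q m - q k \<in> W n" using cauchy by metis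
  \<comment> \<open>Partial sums make the indices increase while still exceeding
    \<open>N (Suc k)\<close>.\<close>
  define r where "r k = (\<Sum>i\<le>Suc k. N i)" for k
  have r: "N (Suc k) \<le> r k" "r k \<le> r (Suc k)" for k by (simp_all add: r_def)
  obtain l where l: "0 \<le> l" "l \<le> x" "\<And>i. q (r (Suc i)) - l \<in> W i"
  proof (rule fatou_summable_limit[OF dc W cl, of "\<lambda>k. q (r k)" x])
    show "q (r (Suc k)) - q (r k) \<in> W (Suc k)" for k
      using N[of "Suc k"] r(1)[of k] r(2)[of k] by simp
  qed (use q in auto)
  have "\<exists>M. \<forall>m\<ge>M. q m - l \<in> W n" for n
  proof (intro exI allI impI)
    fix m assume m: "m \<ge> r (Suc (Suc n))"
    \<comment> \<open>With this index both \<open>q m - q ?k\<close> and \<open>q ?k - l\<close> lie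
      in \<open>W (Suc n)\<close>, so their sum lies in \<open>W n\<close>.\<close>
    let ?k = "r (Suc (Suc n))"
    have "q m - q ?k \<in> W (Suc (Suc (Suc n)))"
      using N[of "Suc (Suc (Suc n))"] r(1)[of "Suc (Suc n)"] m by simp
    then have "q m - q ?k \<in> W (Suc n)"
      using normal_seq_antimono[OF W, of "Suc n" "Suc (Suc (Suc n))"] by auto
    from normal_seq_add[OF W this l(3)] show "q m - l \<in> W n" by simp
  qed
  with l(1,2) show ?thesis by blast
qed

section \<open>Principal bands and the extension to the Dedekind completion\<close>

lemma band_gen_ideal: "ideal_vl (band_gen x)"
proof (rule additive_solid_ideal)
  show "0 \<in> band_gen x" by (auto simp: band_gen_def band_vl_def ideal_vl_def)
  show "solid (band_gen x)"
    by (rule solidI) (auto simp: band_gen_def band_vl_def ideal_vl_def intro: solid_inD)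
  show "a + b \<in> band_gen x" if "a \<in> band_gen x" "b \<in> band_gen x" for a b
    using that by (auto simp: band_gen_def band_vl_def ideal_vl_def)
qed

lemma self_mem_band_gen: "x \<in> band_gen x"
  by (simp add: band_gen_def)

lemma order_interval_band_gen: "y \<in> order_interval 0 x \<Longrightarrow> y \<in> band_gen x"
  using band_gen_ideal[of x] solid_between[OF _ self_mem_band_gen, of x y]
  by (auto simp: order_interval_def ideal_vl_def)

text \<open>The band \<open>dcompl {y}\<close> contains \<open>x\<close>, hence all of
  \<open>band_gen x\<close>, so \<open>y\<close> is disjoint from itself.\<close>

lemma band_gen_disjoint:
  assumes "y \<in> band_gen x" "inf (vabs x) (vabs y) = 0"
  shows "y = 0"
proof -
  have "x \<in> dcompl {y}" using assms(2) by (simp add: dcompl_def)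
  then have "y \<in> dcompl {y}" using assms(1) dcompl_band by (auto simp: band_gen_def)
  then show ?thesis by (simp add: dcompl_def)
qed

lemma dedekind_embedding_mono:
  assumes "dedekind_completion_embedding j"
  shows "j a \<le> j b \<longleftrightarrow> a \<le> b"
  using assms unfolding dedekind_completion_embedding_def
  by (metis injD sup.absorb_iff2)

lemma fatou_extension_lics:
  fixes T :: "'a::vector_lattice topology" and j :: "'a \<Rightarrow> 'b::vector_lattice"
  assumes carrier: "carrier_top T = UNIV" and j: "dedekind_completion_embedding j"
    and Td: "fatou_topology Td" and ext: "extends_topology j T Td"
  shows "lics_submetrisable Td"
  unfolding lics_submetrisable_def
proof (intro allI impI)
  fix x :: 'b assume x: "0 \<le> x"
  have dc: "dedekind_complete TYPE('b)" and lin: "linear j" and major: "\<exists>e. y \<le> j e"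
    and dense: "0 < y \<Longrightarrow> \<exists>e. 0 < j e \<and> j e \<le> y" for y
    using j by (auto simp: dedekind_completion_embedding_def)
  note mono = dedekind_embedding_mono[OF j]
  have j0: "j 0 = 0" using lin by (rule linear_0)
  obtain e where e: "x \<le> j e" using major by blast
  have "e \<in> carrier_top T" using carrier by simp
  then obtain V where V: "normal_solid_seq T V" "e \<in> dcompl (\<Inter> (range V))"
    by (auto simp: carrier_top_iff)
  have "\<exists>U. nhd0 Td U \<and> j -` U \<subseteq> V n" for n
  proof -
    obtain O' where O: "openin T O'" "0 \<in> O'" "O' \<subseteq> V n"
      using normal_seq_nhd0[OF V(1), of n] by (auto simp: nhd0_def)
    then obtain Q where Q: "openin Td Q" "O' = j -` Q" using ext by (auto simp: extends_topology_def)
    have "nhd0 Td Q" unfolding nhd0_def using O Q j0 by (intro exI[of _ Q]) auto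
    then show ?thesis using O Q by blast
  qed
  then obtain U where U: "\<And>n. nhd0 Td (U n)" "\<And>n. j -` U n \<subseteq> V n" by metis
  obtain W where W: "normal_solid_seq Td W" and W_closed: "\<And>n. order_closed (W n)" and W_U: "\<And>n. W n \<subseteq> U n"
    using fatou_normal_seq[OF Td, of U, OF U(1)] by blast
  note sol = normal_seq_solid[OF W]
  have disj: "inf (vabs x) (vabs y) = 0" if y: "\<And>n. y \<in> W n" for y
  proof (rule ccontr)
    assume "inf (vabs x) (vabs y) \<noteq> 0"
    then have "0 < inf (vabs x) (vabs y)" by (simp add: order.not_eq_order_implies_strict)
    \<comment> \<open>Order density pulls the failure of disjointness back to the original lattice:
      \<open>a\<close> is positive, below \<open>e\<close>, and in the kernel of \<open>V\<close>,
      contradicting the choice of \<open>V\<close>.\<close>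
    then obtain a where a: "0 < j a" "j a \<le> inf (vabs x) (vabs y)" using dense by blast
    then have "j a \<le> j e" using x e by (auto intro: order_trans)
    then have ae: "0 \<le> a" "a \<le> e" using a(1) mono[of a e] mono[of 0 a] j0 by auto
    have "j a \<in> W n" for n by (rule solid_inD[OF sol y]) (use a in auto)
    then have "a \<in> \<Inter> (range V)" using W_U U(2) by blast
    with V(2) have "inf (vabs e) (vabs a) = 0" by (rule dcompl_D)
    moreover have "inf (vabs e) (vabs a) = a" using ae by (simp add: inf_absorb2)
    ultimately show False using a(1) j0 by simp
  qed
  \<comment> \<open>Separation on the band: an element of \<open>band_gen x\<close> in every
    \<open>W n\<close> is disjoint from \<open>x\<close> and therefore zero.\<close>
  obtain \<sigma> where \<sigma>: "locally_solid_on (band_gen x) \<sigma>" "metrizable_space \<sigma>"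
    "\<And>U. openin \<sigma> U \<Longrightarrow> openin (subtopology Td (band_gen x)) U"
    and nhd: "\<And>n. nhd0 \<sigma> (W n \<inter> band_gen x)"
    and base: "\<And>U y. openin \<sigma> U \<Longrightarrow> y \<in> U \<Longrightarrow> \<exists>n. \<forall>z\<in>band_gen x. z - y \<in> W n \<longrightarrow> z \<in> U"
    by (rule normal_seq_metrizable_topology[OF fatou_linear[OF Td] W band_gen_ideal[of x]])
      (use band_gen_disjoint disj in blast)+
  have top: "topspace \<sigma> = band_gen x"
    using \<sigma>(1) by (simp add: locally_solid_on_def linear_topology_on_def)
  have "\<exists>l\<in>order_interval 0 x. limitin \<sigma> s l sequentially"
    if s: "\<forall>n. s n \<in> order_interval 0 x" "cauchy_in_lt \<sigma> s" for s
  proof -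
    have "\<exists>N. \<forall>m\<ge>N. \<forall>k\<ge>N. s m - s k \<in> W n" for n
      using s(2) nhd[of n] unfolding cauchy_in_lt_def by blast
    moreover have "0 \<le> s k" "s k \<le> x" for k using s(1) by (simp_all add: order_interval_def)
    ultimately obtain l where l: "0 \<le> l" "l \<le> x" "\<forall>n. \<exists>N. \<forall>m\<ge>N. s m - l \<in> W n"
      using fatou_cauchy_limit[OF dc W W_closed, of s x] by metis
    then have "l \<in> order_interval 0 x" by (simp add: order_interval_def)
    moreover have "limitin \<sigma> s l sequentially"
      unfolding limitin_def eventually_sequentially
    proof (intro conjI allI impI)
      show "l \<in> topspace \<sigma>" using calculation order_interval_band_gen top by blast
      fix O' assume "openin \<sigma> O' \<and> l \<in> O'"
      then obtain n where "\<forall>z\<in>band_gen x. z - l \<in> W n \<longrightarrow> z \<in> O'" using base by blast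
      moreover have "s k \<in> band_gen x" for k using s(1) order_interval_band_gen by blast
      ultimately show "\<exists>N. \<forall>m\<ge>N. s m \<in> O'" using l(3) by meson
    qed
    ultimately show ?thesis by blast
  qed
  with \<sigma> show "\<exists>\<sigma>x. locally_solid_on (band_gen x) \<sigma>x \<and> metrizable_space \<sigma>x \<and>
        (\<forall>U. openin \<sigma>x U \<longrightarrow> openin (subtopology Td (band_gen x)) U) \<and>
        (\<forall>s. (\<forall>n. s n \<in> order_interval 0 x) \<and> cauchy_in_lt \<sigma>x s \<longrightarrow>
             (\<exists>l\<in>order_interval 0 x. limitin \<sigma>x s l sequentially))"
    by blast
qed

theorem theorem3p17:
  fixes T :: "'a::archimedean_vector_lattice topology"
  assumes "fatou_topology T"
  shows "(countable_sup_property TYPE('a) \<longrightarrow> carrier_top T = UNIV)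
     \<and> ((\<exists>A. countable A \<and> order_basis_of (carrier_top T) A) \<longrightarrow> carrier_top T = UNIV)
     \<and> (metrizable_space T \<longrightarrow> carrier_top T = UNIV)
     \<and> (\<forall>(j::'a \<Rightarrow> 'b::archimedean_vector_lattice) Td.
          carrier_top T = UNIV \<and> dedekind_completion_embedding j \<and>
          fatou_topology Td \<and> extends_topology j T Td
          \<longrightarrow> lics_submetrisable Td)"
  using carrier_top_countable_sup[OF assms] carrier_top_countable_basis[OF assms]
    carrier_top_metrizable[OF assms] fatou_extension_lics[of T]
  by blast

end
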